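(* Let $n\ge 2$ be an integer and let $\mathcal{M}$ be a von Neumann algebra with no central summands of type $I_1$. Then for every multiplicative generalized Jordan $n$-derivation $\Delta:\mathcal{M}\rightarrow\mathcal{M}$ there exist $\mu\in\mathcal{Z}(\mathcal{M})$ and a derivation $\delta:\mathcal{M}\rightarrow\mathcal{M}$ such that $\Delta(t)=\mu t+\delta(t)$ for all $t\in\mathcal{M}$.
   Context: A von Neumann algebra $\mathcal{M}$ is a $C^{*}$-subalgebra of the algebra $\mathcal{B}(\mathcal{H})$ of bounded linear operators on a complex Hilbert space $\mathcal{H}$ that is closed in the strong operator topology and contains the identity operator. $\mathcal{Z}(\mathcal{M})$ is the center of $\mathcal{M}$. The Jordan product is $t_1\circ t_2=t_1t_2+t_2t_1$. Set $q_1(t_1)=t_1$ and $q_n(t_1,\ldots,t_n)=q_{n-1}(t_1,\ldots,t_{n-1})\circ t_n$ for $n\ge 2$. A map $\delta:\mathcal{M}\to\mathcal{M}$ (not assumed additive) is a multiplicative Jordan $n$-derivation if $\delta(q_n(t_1,\ldots,t_n))=\sum_{i=1}^n q_n(t_1,\ldots,t_{i-1},\delta(t_i),t_{i+1},\ldots,t_n)$ for all $t_1,\ldots,t_n\in\mathcal{M}$. A map $\Delta:\mathcal{M}\to\mathcal{M}$ (not assumed additive) is a multiplicative generalized Jordan $n$-derivation if there exists a multiplicative Jordan $n$-derivation $\delta:\mathcal{M}\to\mathcal{M}$ (not assumed additive) such that $\Delta(q_n(t_1,\ldots,t_n))=q_n(\Delta(t_1),t_2,\ldots,t_n)+\sum_{i=2}^n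 q_n(t_1,\ldots,t_{i-1},\delta(t_i),t_{i+1},\ldots,t_n)$ for all $t_1,\ldots,t_n\in\mathcal{M}$. A derivation is an additive map $d$ (not assumed linear) with $d(t_1t_2)=d(t_1)t_2+t_1d(t_2)$ for all $t_1,t_2$. *)

theory Defs
  imports "HOL-Analysis.Analysis"
begin

section \<open>Complex Hilbert spaces\<close>

text \<open>The norm, the metric and the real scalar multiplication are inherited from the class of real
  Banach spaces, so completeness is part of the class. The last axiom ties the norm to the inner
  product; since the norm is definite, it also makes the inner product positive definite. The inner
  product is linear in its first argument.\<close>

class chilbert_space = banach +
  fixes scaleC :: "complex \<Rightarrow> 'a \<Rightarrow> 'a"  (infixr "*\<^sub>C" 75)
    and cinner :: "'a \<Rightarrow> 'a \<Rightarrow> complex"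
  assumes scaleC_add_right: "a *\<^sub>C (x + y) = a *\<^sub>C x + a *\<^sub>C y"
    and scaleC_add_left: "(a + b) *\<^sub>C x = a *\<^sub>C x + b *\<^sub>C x"
    and scaleC_scaleC: "a *\<^sub>C (b *\<^sub>C x) = (a * b) *\<^sub>C x"
    and scaleR_scaleC: "r *\<^sub>R x = complex_of_real r *\<^sub>C x"
    and cinner_commute: "cinner x y = cnj (cinner y x)"
    and cinner_add_left: "cinner (x + y) z = cinner x z + cinner y z"
    and cinner_scaleC_left: "cinner (a *\<^sub>C x) y = a * cinner x y"
    and cinner_eq_norm: "cinner x x = complex_of_real ((norm x)\<^sup>2)"

instantiation complex :: chilbert_space
begin

definition scaleC_complex :: "complex \<Rightarrow> complex \<Rightarrow> complex"
  where "scaleC_complex a x = a * x"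

definition cinner_complex :: "complex \<Rightarrow> complex \<Rightarrow> complex"
  where "cinner_complex x y = x * cnj y"

instance
  by standard
    (simp_all add: scaleC_complex_def cinner_complex_def algebra_simps scaleR_conv_of_real
      complex_norm_square[symmetric])

end

lemma norm_scaleC: "norm (a *\<^sub>C x) = cmod a * norm (x :: 'a :: chilbert_space)"
proof -
  have "complex_of_real ((norm (a *\<^sub>C x))\<^sup>2) = a * cinner x (a *\<^sub>C x)"
    by (simp only: cinner_eq_norm[symmetric] cinner_scaleC_left)
  also have "\<dots> = a * cnj a * cinner x x"
    by (simp add: cinner_commute[of x "a *\<^sub>C x"] cinner_scaleC_left cinner_eq_norm)
  also have "\<dots> = complex_of_real ((cmod a * norm x)\<^sup>2)"
    by (simp only: cinner_eq_norm complex_norm_square power_mult_distrib of_real_mult)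
  finally have "(norm (a *\<^sub>C x))\<^sup>2 = (cmod a * norm x)\<^sup>2"
    by (simp only: of_real_eq_iff)
  then show ?thesis
    by (simp add: power2_eq_iff_nonneg)
qed

lemma bounded_linear_scaleC: "bounded_linear (\<lambda>x :: 'a :: chilbert_space. a *\<^sub>C x)"
  by (rule bounded_linear_intro[where K = "cmod a"])
    (simp_all add: scaleC_add_right scaleR_scaleC scaleC_scaleC norm_scaleC mult.commute)

section \<open>Operators and von Neumann algebras\<close>

text \<open>The library type of bounded operators consists of the real linear ones, with the operator
  norm. The algebra of bounded complex linear operators is the following subset of it.\<close>

definition clinear_ops :: "('h :: chilbert_space \<Rightarrow>\<^sub>L 'h) set"
  where "clinear_ops = {T. \<forall>a x. blinfun_apply T (a *\<^sub>C x) = a *\<^sub>C blinfun_apply T x}"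

lift_definition scaleC_op :: "complex \<Rightarrow> ('h :: chilbert_space \<Rightarrow>\<^sub>L 'h) \<Rightarrow> ('h \<Rightarrow>\<^sub>L 'h)"
  is "\<lambda>a T x. a *\<^sub>C T x"
  using bounded_linear_compose[OF bounded_linear_scaleC] .

definition is_adjoint :: "('h :: chilbert_space \<Rightarrow>\<^sub>L 'h) \<Rightarrow> ('h \<Rightarrow>\<^sub>L 'h) \<Rightarrow> bool"
  where "is_adjoint S T \<longleftrightarrow>
    (\<forall>x y. cinner (blinfun_apply S x) y = cinner x (blinfun_apply T y))"

definition cstar_subalgebra :: "('h :: chilbert_space \<Rightarrow>\<^sub>L 'h) set \<Rightarrow> bool"
  where "cstar_subalgebra M \<longleftrightarrow>
    M \<subseteq> clinear_ops \<and>
    0 \<in> M \<and>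
    (\<forall>S\<in>M. \<forall>T\<in>M. S + T \<in> M) \<and>
    (\<forall>a. \<forall>T\<in>M. scaleC_op a T \<in> M) \<and>
    (\<forall>S\<in>M. \<forall>T\<in>M. S o\<^sub>L T \<in> M) \<and>
    (\<forall>T\<in>M. \<exists>S\<in>M. is_adjoint S T) \<and>
    closed M"

definition von_neumann_algebra :: "('h :: chilbert_space \<Rightarrow>\<^sub>L 'h) set \<Rightarrow> bool"
  where "von_neumann_algebra M \<longleftrightarrow>
    cstar_subalgebra M \<and> id_blinfun \<in> M \<and> closedin strong_operator_topology M"

definition center :: "('h :: chilbert_space \<Rightarrow>\<^sub>L 'h) set \<Rightarrow> ('h \<Rightarrow>\<^sub>L 'h) set"
  where "center M = {z \<in> M. \<forall>T\<in>M. z o\<^sub>L T = T o\<^sub>L z}"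

definition is_projection :: "('h :: chilbert_space \<Rightarrow>\<^sub>L 'h) \<Rightarrow> bool"
  where "is_projection p \<longleftrightarrow> p o\<^sub>L p = p \<and> is_adjoint p p"

definition abelian_projection ::
    "('h :: chilbert_space \<Rightarrow>\<^sub>L 'h) set \<Rightarrow> ('h \<Rightarrow>\<^sub>L 'h) \<Rightarrow> bool"
  where "abelian_projection M p \<longleftrightarrow>
    p \<in> M \<and> is_projection p \<and>
    (\<forall>S\<in>M. \<forall>T\<in>M.
      (p o\<^sub>L S o\<^sub>L p) o\<^sub>L (p o\<^sub>L T o\<^sub>L p) = (p o\<^sub>L T o\<^sub>L p) o\<^sub>L (p o\<^sub>L S o\<^sub>L p))"

text \<open>A von Neumann algebra is of type \<open>I\<^sub>n\<close> if its unit is the sum of \<open>n\<close> equivalent abelian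
  projections; for \<open>n = 1\<close> the unit itself is abelian. The central summands of \<open>M\<close> are the algebras
  \<open>z M = z M z\<close>, with unit \<open>z\<close>, for nonzero central projections \<open>z\<close>.\<close>

definition no_central_summand_type_I1 :: "('h :: chilbert_space \<Rightarrow>\<^sub>L 'h) set \<Rightarrow> bool"
  where "no_central_summand_type_I1 M \<longleftrightarrow>
    \<not> (\<exists>z \<in> center M. z \<noteq> 0 \<and> is_projection z \<and> abelian_projection M z)"

section \<open>Jordan n-derivations\<close>

definition jordan_prod ::
    "('h :: chilbert_space \<Rightarrow>\<^sub>L 'h) \<Rightarrow> ('h \<Rightarrow>\<^sub>L 'h) \<Rightarrow> ('h \<Rightarrow>\<^sub>L 'h)"
  where "jordan_prod s t = (s o\<^sub>L t) + (t o\<^sub>L s)"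

text \<open>\<open>jordan_q [t\<^sub>1, \<dots>, t\<^sub>n]\<close> is the iterated product \<open>q\<^sub>n(t\<^sub>1, \<dots>, t\<^sub>n)\<close>; the value on the empty list
  is never used. List positions start at 0, so \<open>t\<^sub>i\<close> sits at position \<open>i - 1\<close>.\<close>

definition jordan_q :: "('h :: chilbert_space \<Rightarrow>\<^sub>L 'h) list \<Rightarrow> ('h \<Rightarrow>\<^sub>L 'h)"
  where "jordan_q ts = foldl jordan_prod (hd ts) (tl ts)"

lemma jordan_q_singleton: "jordan_q [t] = t"
  by (simp add: jordan_q_def)

lemma jordan_q_snoc: "ts \<noteq> [] \<Longrightarrow> jordan_q (ts @ [t]) = jordan_prod (jordan_q ts) t"
  by (simp add: jordan_q_def)

definition mult_jordan_derivation ::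
    "nat \<Rightarrow> ('h :: chilbert_space \<Rightarrow>\<^sub>L 'h) set \<Rightarrow> (('h \<Rightarrow>\<^sub>L 'h) \<Rightarrow> ('h \<Rightarrow>\<^sub>L 'h)) \<Rightarrow> bool"
  where "mult_jordan_derivation n M \<delta> \<longleftrightarrow>
    \<delta> \<in> M \<rightarrow> M \<and>
    (\<forall>ts. length ts = n \<and> set ts \<subseteq> M \<longrightarrow>
      \<delta> (jordan_q ts) = (\<Sum>i = 0..<n. jordan_q (ts[i := \<delta> (ts ! i)])))"

definition mult_gen_jordan_derivation ::
    "nat \<Rightarrow> ('h :: chilbert_space \<Rightarrow>\<^sub>L 'h) set \<Rightarrow> (('h \<Rightarrow>\<^sub>L 'h) \<Rightarrow> ('h \<Rightarrow>\<^sub>L 'h)) \<Rightarrow> bool"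
  where "mult_gen_jordan_derivation n M \<Delta> \<longleftrightarrow>
    \<Delta> \<in> M \<rightarrow> M \<and>
    (\<exists>\<delta>. mult_jordan_derivation n M \<delta> \<and>
      (\<forall>ts. length ts = n \<and> set ts \<subseteq> M \<longrightarrow>
        \<Delta> (jordan_q ts) =
          jordan_q (ts[0 := \<Delta> (ts ! 0)]) + (\<Sum>i = 1..<n. jordan_q (ts[i := \<delta> (ts ! i)]))))"

definition derivation_on ::
    "('h :: chilbert_space \<Rightarrow>\<^sub>L 'h) set \<Rightarrow> (('h \<Rightarrow>\<^sub>L 'h) \<Rightarrow> ('h \<Rightarrow>\<^sub>L 'h)) \<Rightarrow> bool"
  where "derivation_on M d \<longleftrightarrow>
    d \<in> M \<rightarrow> M \<and>
    (\<forall>s\<in>M. \<forall>t\<in>M. d (s + t) = d s + d t) \<and>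
    (\<forall>s\<in>M. \<forall>t\<in>M. d (s o\<^sub>L t) = (d s o\<^sub>L t) + (s o\<^sub>L d t))"

end

theory Submission
  imports Defs
begin

text \<open>
The proof separates algebra from operator theory. Write \<open>jp a b = (a b + b a) / 2\<close>.

Only tuples of the form \<open>(x, y, 1, \<dots>, 1)\<close> are needed. On them \<open>q\<^sub>n\<close> is \<open>2\<^sup>n\<^sup>-\<^sup>1 jp x y\<close>, and
comparing the tuples \<open>(x, y, 1, \<dots>)\<close> and \<open>(jp x y, 1, 1, \<dots>)\<close>, which have the same product, removes
the number \<open>n\<close>: the Jordan derivation \<open>\<delta>\<close> satisfies
\<open>\<delta> (jp x y) = jp (\<delta> x) y + jp x (\<delta> y) - jp (jp x y) (\<delta> 1)\<close>, and \<open>\<phi> = \<Delta> - \<delta>\<close> satisfies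
\<open>\<phi> (jp x y) = jp (\<phi> x) y\<close>. The second identity forces \<open>\<phi>\<close> to be multiplication by the central element
\<open>\<phi> 1\<close> (\<open>jordan_multiplier\<close>). The first one, applied to idempotents, forces \<open>\<delta> 1\<close> to be central, and
then \<open>d x = \<delta> x - \<delta> 1 x\<close> obeys \<open>d (jp x y) = jp (d x) y + jp x (d y)\<close>
(\<open>twisted_jordan_derivation\<close>). If \<open>d\<close> is a derivation, then \<open>\<Delta> x = (\<phi> 1 + \<delta> 1) x + d x\<close> is the
required decomposition.

That \<open>d\<close> is additive comes from idempotents (\<open>delta_additive\<close>). For an idempotent \<open>e\<close>, subtract an
inner derivation so that \<open>d e = 0\<close>; then \<open>d\<close> respects the Peirce decomposition relative to \<open>e\<close>, and
the usual manipulation of Peirce components yields \<open>d (x + y) = d x + d y\<close> up to an error that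
annihilates the ideal generated by \<open>e A (1 - e)\<close> and \<open>(1 - e) A e\<close>. The error does not depend on
\<open>e\<close>, so it vanishes if the annihilators of these ideals, for all idempotents together, have
intersection \<open>0\<close>. Once \<open>d\<close> is additive, Bresar's argument
for semiprime rings shows that it is a derivation (\<open>delta_derivation\<close>).

The algebra therefore asks two things of a von Neumann algebra: it is semiprime, which is
immediate from the adjoint, and no nonzero \<open>x\<close> satisfies \<open>x M [e, M] = 0\<close> for every idempotent \<open>e\<close>
(\<open>idempotents_faithful_star\<close>). Given such an \<open>x\<close>, the complement \<open>z\<close> of its kernel projection has the
same property, and semiprimeness makes every element of \<open>z M\<close> commute with every idempotent. An
element that commutes with all projections of \<open>M\<close> commutes with \<open>M\<close> (\<open>commutes_projections_central\<close>),
so \<open>z\<close> is a central abelian projection, hence \<open>0\<close>.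

The spectral theory behind this is obtained from a single construction, the strong limit of the
Newton--Schulz polynomials \<open>s \<mapsto> s (3 - s\<^sup>2) / 2\<close> at a self-adjoint contraction \<open>a\<close>, which is the sign
of \<open>a\<close> (\<open>sign_operator\<close>). It provides kernel projections, and projections that cut the spectrum in two
halves; repeated halving reduces a self-adjoint operator to parts that are nearly scalar.
\<close>

section \<open>Subalgebras and the normalized Jordan product\<close>

text \<open>The equation \<open>0 = 1\<close> is not excluded, because the operators on the zero Hilbert space are an instance.\<close>
class real_unital_algebra = real_algebra + monoid_mult

definition jp :: "'r::real_unital_algebra \<Rightarrow> 'r \<Rightarrow> 'r"
  where "jp a b = (1/2) *\<^sub>R (a * b + b * a)"

lemma jp_double: "jp a b + jp a b = a * b + b * a"
  unfolding jp_def by (metis scaleR_add_right scaleR_half_double)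

lemma jp_commute: "jp a b = jp b a"
  by (simp add: jp_def add.commute)

lemma jp_add_left: "jp (a + b) c = jp a c + jp b c"
  by (simp add: jp_def algebra_simps)

lemma jp_add_right: "jp c (a + b) = jp c a + jp c b"
  by (simp add: jp_def algebra_simps)

lemma jp_diff_left: "jp (a - b) c = jp a c - jp b c"
  by (simp add: jp_def algebra_simps)

lemma jp_diff_right: "jp c (a - b) = jp c a - jp c b"
  by (simp add: jp_def algebra_simps)

lemma jp_scaleR_left: "jp (r *\<^sub>R a) b = r *\<^sub>R jp a b"
  by (simp add: jp_def algebra_simps)

lemma jp_zero_left [simp]: "jp 0 a = 0"
  and jp_zero_right [simp]: "jp a 0 = 0"
  by (simp_all add: jp_def)

lemma jp_one_left [simp]: "jp 1 a = a"
  and jp_one_right [simp]: "jp a 1 = a"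
  by (simp_all add: jp_def)

lemma double_cancel: "x + x = y + y \<Longrightarrow> x = (y::'r::real_vector)"
  by (metis scaleR_half_double)

locale unital_subalgebra =
  fixes A :: "'r::real_unital_algebra set"
  assumes one_mem [simp, intro]: "1 \<in> A"
    and add_mem [simp, intro]: "x \<in> A \<Longrightarrow> y \<in> A \<Longrightarrow> x + y \<in> A"
    and mult_mem [simp, intro]: "x \<in> A \<Longrightarrow> y \<in> A \<Longrightarrow> x * y \<in> A"
    and scaleR_mem [simp, intro]: "x \<in> A \<Longrightarrow> r *\<^sub>R x \<in> A"
begin

lemma zero_mem [simp, intro]: "0 \<in> A"
  using scaleR_mem[OF one_mem, of 0] by simp

lemma diff_mem [simp, intro]: "x \<in> A \<Longrightarrow> y \<in> A \<Longrightarrow> x - y \<in> A"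
  using add_mem[OF _ scaleR_mem[of y "-1"]] by simp

lemma jp_mem [simp, intro]: "x \<in> A \<Longrightarrow> y \<in> A \<Longrightarrow> jp x y \<in> A"
  by (simp add: jp_def)

end

text \<open>The second axiom says that the commutators with idempotents are plentiful enough for their two-sided
ideal to have zero annihilator. It is what the absence of abelian summands contributes.\<close>
locale semiprime_with_idempotents = unital_subalgebra +
  assumes semiprime: "x \<in> A \<Longrightarrow> (\<And>y. y \<in> A \<Longrightarrow> x * y * x = 0) \<Longrightarrow> x = 0"
    and idempotents_faithful: "x \<in> A \<Longrightarrow>
      (\<And>e y z. e \<in> A \<Longrightarrow> e * e = e \<Longrightarrow> y \<in> A \<Longrightarrow> z \<in> A \<Longrightarrow> x * y * (e * z - z * e) = 0) \<Longrightarrow> x = 0"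
begin

text \<open>This is the annihilator of the two-sided ideal generated by the off-diagonal Peirce spaces
\<open>e A (1 - e)\<close> and \<open>(1 - e) A e\<close>; the factor \<open>y\<close> makes it a two-sided ideal itself.\<close>
definition offdiag_ann :: "'a \<Rightarrow> 'a set"
  where "offdiag_ann e = {x \<in> A. \<forall>y\<in>A. \<forall>z\<in>A.
    x * y * (e * z * (1 - e)) = 0 \<and> x * y * ((1 - e) * z * e) = 0}"

lemma offdiag_ann_Inter:
  assumes "\<And>e. e \<in> A \<Longrightarrow> e * e = e \<Longrightarrow> x \<in> offdiag_ann e" "x \<in> A"
  shows "x = 0"
proof (rule idempotents_faithful[OF \<open>x \<in> A\<close>])
  fix e y z assume *: "e \<in> A" "e * e = e" "y \<in> A" "z \<in> A"
  have "e * z - z * e = e * z * (1 - e) - (1 - e) * z * e"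
    by (simp add: algebra_simps)
  moreover have "x * y * (e * z * (1 - e)) = 0" "x * y * ((1 - e) * z * e) = 0"
    using assms(1)[OF *(1,2)] * by (auto simp: offdiag_ann_def)
  ultimately show "x * y * (e * z - z * e) = 0"
    by (metis diff_self right_diff_distrib)
qed

text \<open>For an idempotent \<open>e\<close> the element \<open>e + e y (1 - e)\<close> is idempotent again, so \<open>d\<close> commutes with the
off-diagonal Peirce spaces of \<open>e\<close>. If \<open>r\<close> lies in one of them, \<open>a r\<close> is composed of off-diagonal
elements, which gives \<open>[d, a] r = d (a r) - (a r) d = 0\<close>. Thus \<open>[d, a]\<close> annihilates all off-diagonal
spaces.\<close>
lemma commutes_idempotents_central:
  assumes d: "d \<in> A" and comm: "\<And>e. e \<in> A \<Longrightarrow> e * e = e \<Longrightarrow> d * e = e * d" and a: "a \<in> A"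
  shows "d * a = a * d"
proof -
  have off: "d * (e * y * (1 - e)) = e * y * (1 - e) * d"
    if "e \<in> A" "e * e = e" "y \<in> A" for e y
  proof -
    have ee: "e * (e * x) = e * x" for x by (metis mult.assoc that(2))
    have "(e + e * y * (1 - e)) * (e + e * y * (1 - e)) = e + e * y * (1 - e)"
      by (simp add: algebra_simps ee that)
    then have "d * (e + e * y * (1 - e)) = (e + e * y * (1 - e)) * d"
      using that by (intro comm) auto
    with comm[OF that(1,2)] show ?thesis by (simp add: algebra_simps)
  qed
  have off': "d * ((1 - e) * y * e) = (1 - e) * y * e * d" if "e \<in> A" "e * e = e" "y \<in> A" for e y
    using off[of "1 - e" y] that by (simp add: algebra_simps)
  have key: "(d * b - b * d) * (e * y * (1 - e)) = 0"
    if e: "e \<in> A" "e * e = e" and "y \<in> A" "b \<in> A" for e y b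
  proof -
    have ee: "e * (e * x) = e * x" for x by (metis mult.assoc e(2))
    \<comment> \<open>Both summands of \<open>b * ?r = ?u + ?v * ?r\<close> are products of off-diagonal elements.\<close>
    let ?r = "e * y * (1 - e)" and ?u = "e * (b * e * y) * (1 - e)" and ?v = "(1 - e) * b * e"
    have br: "b * ?r = ?u + ?v * ?r" by (simp add: algebra_simps ee e)
    have r: "d * ?r = ?r * d" and u: "d * ?u = ?u * d" and v: "d * ?v = ?v * d"
      using that by (auto intro: off off')
    have vr: "d * (?v * ?r) = ?v * ?r * d"
      by (metis r v mult.assoc)
    have "d * (b * ?r) = b * ?r * d" unfolding br distrib_left distrib_right u vr ..
    then show ?thesis
      using r by (metis (no_types, lifting) eq_iff_diff_eq_0 left_diff_distrib mult.assoc)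
  qed
  have "d * a - a * d = 0"
  proof (rule offdiag_ann_Inter)
    fix e assume e: "e \<in> A" "e * e = e"
    have key2: "(d * a - a * d) * y * r = 0"
      if "y \<in> A" and r: "\<And>b. b \<in> A \<Longrightarrow> (d * b - b * d) * r = 0" for y r
    proof -
      have "(d * a - a * d) * y * r = (d * (a * y) - a * y * d) * r - a * ((d * y - y * d) * r)"
        by (simp add: algebra_simps)
      then show ?thesis using r[of y] r[of "a * y"] a that(1) by simp
    qed
    show "d * a - a * d \<in> offdiag_ann e"
    proof -
      have f: "(1 - e) * (1 - e) = 1 - e" using e by (simp add: algebra_simps)
      have "(d * b - b * d) * ((1 - e) * z * e) = 0" if "z \<in> A" "b \<in> A" for z b
        using key[OF _ f that] e by auto
      then show ?thesis
        unfolding offdiag_ann_def using d a key[OF e] by (blast intro: key2 diff_mem mult_mem)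
    qed
  qed (use d a in auto)
  then show ?thesis by simp
qed

end

section \<open>Multiplicative Jordan derivations and the Peirce decomposition\<close>

text \<open>Maps that satisfy the Leibniz rule for the normalized Jordan product, without any additivity.\<close>
locale jordan_multiplicative = semiprime_with_idempotents +
  fixes \<delta> :: "'a \<Rightarrow> 'a"
  assumes maps [simp, intro]: "x \<in> A \<Longrightarrow> \<delta> x \<in> A"
    and jordan_rule: "x \<in> A \<Longrightarrow> y \<in> A \<Longrightarrow> \<delta> (jp x y) = jp (\<delta> x) y + jp x (\<delta> y)"
begin

lemma jordan_rule_double:
  assumes "x \<in> A" "y \<in> A"
  shows "\<delta> (jp x y) + \<delta> (jp x y) = \<delta> x * y + y * \<delta> x + (x * \<delta> y + \<delta> y * x)"
  unfolding jordan_rule[OF assms] using jp_double[of "\<delta> x" y] jp_double[of x "\<delta> y"]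
  by (simp add: algebra_simps)

lemma delta_zero [simp]: "\<delta> 0 = 0"
  using jordan_rule[of 0 0] by simp

lemma delta_one [simp]: "\<delta> 1 = 0"
  using jordan_rule[of 1 1] by simp

end

text \<open>An idempotent at which the map vanishes; \<open>normalise_at\<close> reduces every idempotent to this situation.\<close>
locale jordan_multiplicative_at = jordan_multiplicative +
  fixes e
  assumes e_mem [simp, intro]: "e \<in> A" and ee: "e * e = e" and delta_e [simp]: "\<delta> e = 0"
begin

lemma eex: "e * (e * x) = e * x"
  by (metis mult.assoc ee)

text \<open>The Peirce space \<open>e A (1 - e) + (1 - e) A e\<close>, described as the \<open>1/2\<close>-eigenspace of \<open>jp e\<close>.\<close>
definition offdiag :: "'a set"
  where "offdiag = {x \<in> A. e * x + x * e = x}"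

definition off_part :: "'a \<Rightarrow> 'a"
  where "off_part x = e * x + x * e - (e * x * e + e * x * e)"

text \<open>Rewriting \<open>y e\<close> into \<open>y - e y\<close> moves \<open>e\<close> to the left of off-diagonal factors, which turns identities
between Peirce components into a normal form computation.\<close>
lemma offdiag_right:
  assumes "y \<in> offdiag"
  shows "y * e = y - e * y" "y * (e * x) = y * x - e * (y * x)"
proof -
  show *: "y * e = y - e * y" using assms by (simp add: offdiag_def algebra_simps)
  have "y * (e * x) = (y * e) * x" by (simp add: mult.assoc)
  also have "\<dots> = y * x - e * (y * x)" unfolding * by (simp add: algebra_simps)
  finally show "y * (e * x) = y * x - e * (y * x)" .
qed

lemma offdiag_mem: "x \<in> offdiag \<Longrightarrow> x \<in> A"
  by (simp add: offdiag_def)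

lemma off_part_mem [simp, intro]: "x \<in> A \<Longrightarrow> off_part x \<in> A"
  by (simp add: off_part_def)

lemma off_part_offdiag: "x \<in> A \<Longrightarrow> off_part x \<in> offdiag"
  by (simp add: offdiag_def off_part_def algebra_simps ee eex)

lemma off_part_id: "x \<in> offdiag \<Longrightarrow> off_part x = x"
  by (simp add: off_part_def algebra_simps ee eex offdiag_right)

lemma offdiag_iff: "x \<in> offdiag \<longleftrightarrow> x \<in> A \<and> off_part x = x"
  using off_part_id off_part_offdiag offdiag_mem by metis

lemma off_part_add: "off_part (x + y) = off_part x + off_part y"
  and off_part_diff: "off_part (x - y) = off_part x - off_part y"
  and off_part_scaleR: "off_part (r *\<^sub>R x) = r *\<^sub>R off_part x"
  by (simp_all add: off_part_def algebra_simps)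

lemma offdiag_scaleR: "x \<in> offdiag \<Longrightarrow> r *\<^sub>R x \<in> offdiag"
  by (simp add: offdiag_iff off_part_scaleR)

lemma jp_e_offdiag: "x \<in> offdiag \<Longrightarrow> jp e x = (1/2) *\<^sub>R x"
  by (simp add: jp_def offdiag_def)

text \<open>The off-diagonal part is reached from Jordan multiplications by \<open>e\<close> and \<open>1 - e\<close> only, so a map
vanishing at both is compatible with it.\<close>
lemma jp_off_part: "jp e (jp (1 - e) x) = (1/4) *\<^sub>R off_part x"
proof -
  have "e * ((1 - e) * x + x * (1 - e)) + ((1 - e) * x + x * (1 - e)) * e = off_part x"
    by (simp add: off_part_def algebra_simps ee eex)
  then show ?thesis by (simp add: jp_def flip: scaleR_add_right)
qed

lemma delta_compl [simp]: "\<delta> (1 - e) = 0"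
proof -
  have "e * \<delta> (1 - e) + \<delta> (1 - e) * e = 0"
    using jordan_rule_double[of e "1 - e"] by (simp add: jp_def algebra_simps ee)
  moreover have "jp (1 - e) (1 - e) = 1 - e"
    by (rule double_cancel) (simp add: jp_double algebra_simps ee)
  with jordan_rule_double[of "1 - e" "1 - e"]
  have "\<delta> (1 - e) + \<delta> (1 - e) = (\<delta> (1 - e) + \<delta> (1 - e) + (\<delta> (1 - e) + \<delta> (1 - e)))
     - (e * \<delta> (1 - e) + \<delta> (1 - e) * e) - (e * \<delta> (1 - e) + \<delta> (1 - e) * e)"
    by (simp add: algebra_simps)
  ultimately show ?thesis
    using double_cancel[of "\<delta> (1 - e)" 0] by simp
qed

text \<open>The corner \<open>e A e\<close> is the \<open>1\<close>-eigenspace of \<open>jp e\<close>, and \<open>\<delta>\<close> commutes with \<open>jp e\<close>.\<close>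
lemma delta_corner:
  assumes "x \<in> A" "e * x = x" "x * e = x"
  shows "e * \<delta> x = \<delta> x" "\<delta> x * e = \<delta> x"
proof -
  have j: "jp e x = x" by (rule double_cancel) (simp add: jp_double assms)
  have 1: "\<delta> x + \<delta> x = e * \<delta> x + \<delta> x * e"
    using jordan_rule_double[of e x] assms j by simp
  have "e * \<delta> x + e * \<delta> x = e * (e * \<delta> x + \<delta> x * e)"
    using 1 by (simp flip: distrib_left)
  then have 2: "e * \<delta> x = e * (\<delta> x * e)" by (simp only: distrib_left eex add_left_cancel)
  have "\<delta> x * e + \<delta> x * e = (e * \<delta> x + \<delta> x * e) * e"
    using 1 by (simp flip: distrib_right)
  then have 3: "\<delta> x * e = e * (\<delta> x * e)" by (simp only: distrib_right ee add_right_cancel mult.assoc)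
  have 4: "\<delta> x * e = e * \<delta> x" by (rule trans[OF 3 2[symmetric]])
  show "e * \<delta> x = \<delta> x"
    using 1 unfolding 4 by (rule double_cancel[symmetric])
  then show "\<delta> x * e = \<delta> x" unfolding 4 .
qed

text \<open>The Leibniz rule identifies \<open>jp (\<delta> (1/2)) e\<close> with \<open>\<delta> (e/2)\<close>, which lies in the corner \<open>e A e\<close>.\<close>
lemma delta_half_commutes: "e * \<delta> ((1/2) *\<^sub>R 1) = \<delta> ((1/2) *\<^sub>R 1) * e"
proof -
  let ?z = "\<delta> ((1/2) *\<^sub>R 1)"
  have "\<delta> ((1/2) *\<^sub>R e) = jp ?z e"
    using jordan_rule[of "(1/2) *\<^sub>R 1" e] by (simp add: jp_scaleR_left)
  then have "\<delta> ((1/2) *\<^sub>R e) + \<delta> ((1/2) *\<^sub>R e) = ?z * e + e * ?z"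
    by (simp add: jp_double)
  moreover have "e * \<delta> ((1/2) *\<^sub>R e) = \<delta> ((1/2) *\<^sub>R e)" "\<delta> ((1/2) *\<^sub>R e) * e = \<delta> ((1/2) *\<^sub>R e)"
    using delta_corner[of "(1/2) *\<^sub>R e"] by (auto simp: ee)
  ultimately have 1: "e * (?z * e + e * ?z) = ?z * e + e * ?z" "(?z * e + e * ?z) * e = ?z * e + e * ?z"
    by (metis distrib_left distrib_right)+
  from 1 show ?thesis
    by (simp add: algebra_simps ee eex)
qed

end

context jordan_multiplicative
begin

text \<open>The Leibniz rule for \<open>jp e e = e\<close> shows that \<open>\<delta> e\<close> is off-diagonal, hence of the form \<open>e w - w e\<close>.
Subtracting the inner derivation by \<open>w\<close> preserves the Leibniz rule and changes neither values at
scalars nor the deviation from additivity.\<close>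
lemma normalise_at:
  assumes e: "e \<in> A" "e * e = e"
  obtains w where "w \<in> A" "jordan_multiplicative_at A (\<lambda>x. \<delta> x - (x * w - w * x)) e"
proof
  let ?w = "e * \<delta> e * (1 - e) - (1 - e) * \<delta> e * e"
  show w: "?w \<in> A" using e by auto
  have ee: "e * (e * x) = e * x" for x by (metis e(2) mult.assoc)
  have "jp e e = e" by (rule double_cancel) (simp add: jp_double e)
  then have 1: "\<delta> e = \<delta> e * e + e * \<delta> e"
    using jordan_rule_double[of e e] e(1) by - (rule double_cancel, simp add: algebra_simps)
  then have "e * \<delta> e = e * (\<delta> e * e + e * \<delta> e)" by (rule arg_cong)
  then have 2: "e * (\<delta> e * e) = 0"
    by (metis add_cancel_left_left distrib_left ee)
  have "e * ?w - ?w * e = \<delta> e * e + e * \<delta> e"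
    using 2 by (simp add: algebra_simps ee e)
  then have 3: "\<delta> e = e * ?w - ?w * e"
    using 1 by (simp only:)
  have jp_inner: "jp x y * v - v * jp x y = jp (x * v - v * x) y + jp x (y * v - v * y)" for x y v
    by (simp add: jp_def algebra_simps)
  show "jordan_multiplicative_at A (\<lambda>x. \<delta> x - (x * ?w - ?w * x)) e"
  proof unfold_locales
    show "\<delta> e - (e * ?w - ?w * e) = 0" by (rule right_minus_eq[THEN iffD2, OF 3])
  next
    fix x y assume "x \<in> A" "y \<in> A"
    then show "\<delta> (jp x y) - (jp x y * ?w - ?w * jp x y) =
      jp (\<delta> x - (x * ?w - ?w * x)) y + jp x (\<delta> y - (y * ?w - ?w * y))"
      unfolding jp_inner jp_diff_left jp_diff_right jordan_rule[OF \<open>x \<in> A\<close> \<open>y \<in> A\<close>]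
      by simp
  qed (use e w in auto)
qed

lemma delta_half_central: "x \<in> A \<Longrightarrow> \<delta> ((1/2) *\<^sub>R 1) * x = x * \<delta> ((1/2) *\<^sub>R 1)"
proof (rule commutes_idempotents_central)
  fix e assume e: "e \<in> A" "e * e = e"
  then obtain w where "jordan_multiplicative_at A (\<lambda>x. \<delta> x - (x * w - w * x)) e"
    using normalise_at by metis
  from jordan_multiplicative_at.delta_half_commutes[OF this]
  show "\<delta> ((1/2) *\<^sub>R 1) * e = e * \<delta> ((1/2) *\<^sub>R 1)" by simp
qed auto

end

context jordan_multiplicative_at
begin

text \<open>For off-diagonal \<open>x\<close> both \<open>jp e x\<close> and \<open>jp (1/2) x\<close> are \<open>x / 2\<close>. Comparing the off-diagonal parts of
the two Leibniz rules leaves exactly the term \<open>\<delta> (1/2) x\<close>.\<close>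
lemma delta_half_offdiag_ann: "\<delta> ((1/2) *\<^sub>R 1) \<in> offdiag_ann e"
proof -
  let ?z = "\<delta> ((1/2) *\<^sub>R 1)"
  have c: "x * ?z = ?z * x" if "x \<in> A" for x using delta_half_central[OF that] by simp
  have jz: "jp ?z x = ?z * x" if "x \<in> A" for x
    by (rule double_cancel) (simp add: jp_double c that)
  have "?z * x = 0" if x: "x \<in> offdiag" for x
  proof -
    note xA = offdiag_mem[OF x]
    define y where "y = \<delta> x"
    have yA: "y \<in> A" using xA by (simp add: y_def)
    have "e * (?z * x) = ?z * (e * x)"
      using c[of e] by (metis e_mem mult.assoc)
    then have "e * (?z * x) + ?z * x * e = ?z * (e * x + x * e)"
      by (simp only: distrib_left mult.assoc)
    then have zx: "?z * x \<in> offdiag" using x xA by (simp add: offdiag_def)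
    have "jp e x = jp ((1/2) *\<^sub>R 1) x" using jp_e_offdiag[OF x] by (simp add: jp_scaleR_left)
    then have "jp e y = ?z * x + (1/2) *\<^sub>R y"
      using jordan_rule[of e x] jordan_rule[of "(1/2) *\<^sub>R 1" x] xA jz
      by (simp add: y_def jp_scaleR_left)
    then have "off_part (jp e y) = ?z * x + (1/2) *\<^sub>R off_part y"
      using zx by (simp add: off_part_add off_part_scaleR off_part_id)
    moreover have "off_part (jp e y) = (1/2) *\<^sub>R off_part y"
    proof -
      have "off_part (e * y + y * e) = off_part y"
        by (simp add: off_part_def algebra_simps ee eex)
      then show ?thesis by (simp add: jp_def off_part_scaleR)
    qed
    ultimately show ?thesis by simp
  qed
  moreover have "?z * y * r = y * (?z * r)" if "y \<in> A" for y r
    using c[OF that] by (metis mult.assoc)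
  moreover have "e * x * (1 - e) \<in> offdiag" "(1 - e) * x * e \<in> offdiag" if "x \<in> A" for x
    using that by (simp_all add: offdiag_def algebra_simps ee eex)
  ultimately show ?thesis by (simp add: offdiag_ann_def)
qed

end

context jordan_multiplicative
begin

text \<open>Compatibility with halving is the first fragment of additivity; the Peirce computations below use
it to clear the factors \<open>1/2\<close> and \<open>1/4\<close>.\<close>
lemma delta_half [simp]: "\<delta> ((1/2) *\<^sub>R 1) = 0"
proof (rule offdiag_ann_Inter)
  fix e assume e: "e \<in> A" "e * e = e"
  then obtain w where "jordan_multiplicative_at A (\<lambda>x. \<delta> x - (x * w - w * x)) e"
    using normalise_at by metis
  from jordan_multiplicative_at.delta_half_offdiag_ann[OF this]
  show "\<delta> ((1/2) *\<^sub>R 1) \<in> offdiag_ann e" by simp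
qed simp

lemma delta_scale_half: "x \<in> A \<Longrightarrow> \<delta> ((1/2) *\<^sub>R x) = (1/2) *\<^sub>R \<delta> x"
  using jordan_rule[of "(1/2) *\<^sub>R 1" x] by (simp add: jp_scaleR_left)

lemma delta_scale_quarter: "x \<in> A \<Longrightarrow> \<delta> ((1/4) *\<^sub>R x) = (1/4) *\<^sub>R \<delta> x"
  using delta_scale_half[of x] delta_scale_half[of "(1/2) *\<^sub>R x"] by simp

lemma delta_scale_two: "x \<in> A \<Longrightarrow> \<delta> (2 *\<^sub>R x) = 2 *\<^sub>R \<delta> x"
  using delta_scale_half[of "2 *\<^sub>R x"] by simp

end

section \<open>Additivity\<close>

context jordan_multiplicative_at
begin

lemma jp_peirce_left: "x \<in> offdiag \<Longrightarrow> jp (1 - e) x = (1/2) *\<^sub>R x"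
proof -
  assume "x \<in> offdiag"
  then have "(1 - e) * x + x * (1 - e) = x" by (simp add: algebra_simps offdiag_right)
  then show ?thesis by (simp add: jp_def)
qed

lemma off_part_delta: "x \<in> A \<Longrightarrow> off_part (\<delta> x) = \<delta> (off_part x)"
proof -
  assume x: "x \<in> A"
  have "\<delta> (jp e (jp (1 - e) x)) = jp e (jp (1 - e) (\<delta> x))"
    using x by (subst jordan_rule, simp, simp)+ simp
  then have "(1/4) *\<^sub>R \<delta> (off_part x) = (1/4) *\<^sub>R off_part (\<delta> x)"
    unfolding jp_off_part using x by (simp add: delta_scale_quarter)
  then show ?thesis by simp
qed

lemma delta_offdiag: "x \<in> offdiag \<Longrightarrow> \<delta> x \<in> offdiag"
  using off_part_delta[of x] by (simp add: offdiag_iff)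

text \<open>For \<open>r\<close> in \<open>e A (1 - e)\<close> the condition \<open>jp w r = 0\<close> reads \<open>w r = 0\<close> since \<open>r w = 0\<close>; absorbing further
factors into the middle of \<open>e A (1 - e)\<close> gives the two-sided statement.\<close>
lemma offdiag_annI:
  assumes "w \<in> A" "e * w = w" "w * e = w" "\<And>r. r \<in> offdiag \<Longrightarrow> jp w r = 0"
  shows "w \<in> offdiag_ann e"
proof -
  have we: "w * (e * x) = w * x" for x by (metis assms(3) mult.assoc)
  have ew: "e * (w * x) = w * x" for x by (metis assms(2) mult.assoc)
  have 0: "w * (e * y * (1 - e)) = 0" if "y \<in> A" for y
  proof -
    let ?r = "e * y * (1 - e)"
    have "?r \<in> offdiag" using that by (simp add: offdiag_def algebra_simps ee eex)
    then have "w * ?r + ?r * w = 0" using assms(4)[of ?r] jp_double[of w ?r] by simp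
    moreover have "?r * w = 0" by (simp add: algebra_simps assms)
    ultimately show ?thesis by simp
  qed
  show ?thesis
    unfolding offdiag_ann_def
  proof (intro CollectI conjI ballI assms(1))
    fix y z assume y: "y \<in> A" and z: "z \<in> A"
    have "w * y * (e * z * (1 - e)) = w * (e * (y * e * z) * (1 - e))"
      by (simp add: algebra_simps we)
    then show "w * y * (e * z * (1 - e)) = 0" using 0[of "y * e * z"] y z by simp
    have "w * y * ((1 - e) * z * e) = w * (e * y * (1 - e)) * (z * e)"
      by (simp add: algebra_simps we)
    then show "w * y * ((1 - e) * z * e) = 0" using 0[of y] y z by simp
  qed
qed

lemma offdiag_ann_subset: "x \<in> offdiag_ann e \<Longrightarrow> x \<in> A"
  by (simp add: offdiag_ann_def)

lemma offdiag_ann_add: "x \<in> offdiag_ann e \<Longrightarrow> y \<in> offdiag_ann e \<Longrightarrow> x + y \<in> offdiag_ann e"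
  and offdiag_ann_diff: "x \<in> offdiag_ann e \<Longrightarrow> y \<in> offdiag_ann e \<Longrightarrow> x - y \<in> offdiag_ann e"
  unfolding offdiag_ann_def by (simp_all only: mem_Collect_eq distrib_right left_diff_distrib) simp_all

lemma offdiag_ann_scaleR: "x \<in> offdiag_ann e \<Longrightarrow> r *\<^sub>R x \<in> offdiag_ann e"
  unfolding offdiag_ann_def by simp

lemma offdiag_ann_mult_left: "x \<in> offdiag_ann e \<Longrightarrow> y \<in> A \<Longrightarrow> y * x \<in> offdiag_ann e"
  unfolding offdiag_ann_def by (simp add: mult.assoc)

lemma offdiag_ann_mult_right: "x \<in> offdiag_ann e \<Longrightarrow> y \<in> A \<Longrightarrow> x * y \<in> offdiag_ann e"
  unfolding offdiag_ann_def by (auto simp only: mem_Collect_eq mult.assoc intro: mult_mem)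
     (metis mult.assoc mult_mem)+

lemma offdiag_ann_jp_left: "x \<in> offdiag_ann e \<Longrightarrow> y \<in> A \<Longrightarrow> jp x y \<in> offdiag_ann e"
  by (simp add: jp_def offdiag_ann_scaleR offdiag_ann_add offdiag_ann_mult_left offdiag_ann_mult_right)

lemma offdiag_ann_jp_right: "x \<in> offdiag_ann e \<Longrightarrow> y \<in> A \<Longrightarrow> jp y x \<in> offdiag_ann e"
  using offdiag_ann_jp_left by (simp add: jp_commute)

lemma offdiag_ann_off_part: "x \<in> offdiag_ann e \<Longrightarrow> off_part x \<in> offdiag_ann e"
  by (simp add: off_part_def offdiag_ann_add offdiag_ann_diff offdiag_ann_mult_left offdiag_ann_mult_right)

text \<open>An off-diagonal element lies in the ideal that it annihilates, and a semiprime ring has no such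
elements except \<open>0\<close>. This turns congruences into equations for off-diagonal elements.\<close>
lemma offdiag_ann_offdiag:
  assumes "x \<in> offdiag_ann e" "x \<in> offdiag"
  shows "x = 0"
proof (rule semiprime)
  show xA: "x \<in> A" using assms by (simp add: offdiag_ann_subset)
  fix y assume y: "y \<in> A"
  have "x = e * x * (1 - e) + (1 - e) * x * e"
    using assms(2) by (simp add: algebra_simps ee eex offdiag_right)
  then have "x * y * x = x * y * (e * x * (1 - e) + (1 - e) * x * e)" by (rule arg_cong)
  also have "\<dots> = 0"
    using assms(1) xA y by (simp only: offdiag_ann_def distrib_left mem_Collect_eq) simp
  finally show "x * y * x = 0" .
qed

lemma corner_jp_offdiag:
  assumes "a \<in> A" "e * a = a" "a * e = a" "r \<in> offdiag"
  shows "jp r a \<in> offdiag"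
proof -
  have ae: "a * (e * x) = a * x" for x by (metis assms(3) mult.assoc)
  have ea: "e * (a * x) = a * x" for x by (metis assms(2) mult.assoc)
  have "e * (r * a) = 0"
  proof -
    have "r * a = r * (e * a)" using assms by simp
    also have "\<dots> = r * a - e * (r * a)" using assms(4) by (rule offdiag_right)
    finally show ?thesis by simp
  qed
  moreover have "a * r * e = 0"
    using offdiag_right(1)[OF assms(4)] by (simp add: mult.assoc right_diff_distrib ae)
  ultimately have "r * a + a * r \<in> offdiag"
    using assms offdiag_mem[OF assms(4)] by (simp add: offdiag_def algebra_simps ea)
  then show ?thesis by (simp add: jp_def offdiag_scaleR)
qed

lemma off_part_jp_offdiag:
  assumes "r \<in> offdiag" "s \<in> offdiag"
  shows "off_part (jp r s) = 0"
proof -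
  have "off_part (r * s + s * r) = 0"
    using assms by (simp add: off_part_def algebra_simps ee eex offdiag_right)
  then show ?thesis by (simp add: jp_def off_part_scaleR)
qed

text \<open>Multiplying by \<open>1 - e\<close> removes \<open>a\<close> and determines all Peirce components of \<open>\<delta> (a + b)\<close> except the one
in \<open>e A e\<close>. That one is compared with \<open>\<delta> a\<close> by multiplying with off-diagonal \<open>r\<close> and taking
off-diagonal parts, which removes \<open>b\<close>.\<close>
lemma delta_add_corner_offdiag:
  assumes a: "a \<in> A" "e * a = a" "a * e = a" and b: "b \<in> offdiag"
  shows "\<delta> (a + b) - (\<delta> a + \<delta> b) \<in> offdiag_ann e"
proof -
  define y where "y = \<delta> (a + b)"
  have bA: "b \<in> A" and db: "\<delta> b \<in> offdiag" and yA: "y \<in> A"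
    using b offdiag_mem delta_offdiag a by (auto simp: y_def)
  have da: "e * \<delta> a = \<delta> a" "\<delta> a * e = \<delta> a" using delta_corner a by auto
  have "jp (1 - e) a = 0" using a by (simp add: jp_def algebra_simps)
  then have "jp (1 - e) (a + b) = (1/2) *\<^sub>R b"
    by (simp add: jp_add_right jp_peirce_left b)
  then have "jp (1 - e) y = (1/2) *\<^sub>R \<delta> b"
    using jordan_rule[of "1 - e" "a + b"] a bA by (simp add: y_def delta_scale_half)
  then have "(1 - e) * y + y * (1 - e) = \<delta> b"
    by (simp add: jp_def)
  then have y: "y + y = \<delta> b + (e * y + y * e)"
    by (simp add: algebra_simps)
  define u where "u = y - (\<delta> a + \<delta> b)"
  have "e * (y + y) = e * (\<delta> b + (e * y + y * e))" using y by (rule arg_cong)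
  then have "e * y + e * y = e * y + (e * \<delta> b + e * y * e)"
    by (simp only: distrib_left eex mult.assoc add.left_commute add.commute)
  then have ey: "e * y = e * \<delta> b + e * y * e" by (rule add_left_imp_eq)
  have "(y + y) * e = (\<delta> b + (e * y + y * e)) * e" using y by (rule arg_cong)
  then have "y * e + y * e = y * e + (\<delta> b * e + e * y * e)"
    by (simp only: distrib_right ee mult.assoc add.left_commute add.commute)
  then have ye: "y * e = \<delta> b * e + e * y * e" by (rule add_left_imp_eq)
  have s: "e * y + y * e = (e * \<delta> b + e * y * e) + (\<delta> b * e + e * y * e)"
    by (rule arg_cong2[OF ey ye])
  \<comment> \<open>Hence \<open>y\<close> has no component in \<open>(1 - e) A (1 - e)\<close> and its off-diagonal part is \<open>\<delta> b\<close>.\<close>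
  have "y + y = (\<delta> b + e * y * e) + (\<delta> b + e * y * e)"
    unfolding y s using db by (simp add: offdiag_right)
  then have yb: "y = \<delta> b + e * y * e" by (rule double_cancel)
  have u: "u = e * y * e - \<delta> a" unfolding u_def by (subst yb) simp
  have uA: "u \<in> A" using yA a bA by (simp add: u_def)
  have "u \<in> offdiag_ann e"
  proof (rule offdiag_annI[OF uA])
    show "e * u = u" "u * e = u" unfolding u by (simp_all add: algebra_simps da ee eex)
    fix r assume r: "r \<in> offdiag"
    note rA = offdiag_mem[OF r]
    have "off_part (jp r (a + b)) = jp r a"
      using corner_jp_offdiag[OF a r] by (simp add: jp_add_right off_part_add off_part_jp_offdiag r b off_part_id)
    then have "\<delta> (jp r a) = off_part (\<delta> (jp r (a + b)))"
      using off_part_delta[of "jp r (a + b)"] rA a bA by simp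
    also have "\<delta> (jp r (a + b)) = jp (\<delta> r) (a + b) + jp r y"
      using rA a bA by (simp add: jordan_rule y_def)
    also have "\<dots> = jp (\<delta> r) a + jp (\<delta> r) b + (jp r (\<delta> b) + jp r (u + \<delta> a))"
      by (simp add: jp_add_right u_def) (simp add: jp_diff_right jp_add_right)
    also have "off_part \<dots> = jp (\<delta> r) a + jp r (u + \<delta> a)"
    proof -
      have "jp r (u + \<delta> a) \<in> offdiag"
        using uA yA a r by (intro corner_jp_offdiag) (auto simp: mult.assoc ee eex u da)
      moreover have "jp (\<delta> r) a \<in> offdiag"
        using a r by (intro corner_jp_offdiag delta_offdiag)
      ultimately show ?thesis
        by (simp add: off_part_add off_part_jp_offdiag r b db delta_offdiag off_part_id)
    qed
    finally have "jp r u = 0"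
      using jordan_rule[of r a] rA a by (simp add: jp_add_right)
    then show "jp u r = 0" by (simp add: jp_commute)
  qed
  then show ?thesis by (simp add: u_def y_def)
qed

text \<open>Everything is symmetric in \<open>e\<close> and \<open>1 - e\<close>, with the same off-diagonal space and annihilator; the
results for the corner \<open>e A e\<close> carry over to the opposite corner.\<close>
lemma complementary: "jordan_multiplicative_at A \<delta> (1 - e)"
  by unfold_locales (simp_all add: algebra_simps ee)

interpretation compl: jordan_multiplicative_at A \<delta> "1 - e"
  by (rule complementary)

lemma compl_offdiag: "compl.offdiag = offdiag"
proof -
  have "((1 - e) * x + x * (1 - e) = x) = (e * x + x * e = x)" for x
  proof -
    have "(1 - e) * x + x * (1 - e) = (x + x) - (e * x + x * e)" by (simp add: algebra_simps)
    then show ?thesis by auto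
  qed
  then show ?thesis by (simp add: compl.offdiag_def offdiag_def)
qed

lemma compl_ann: "offdiag_ann (1 - e) = offdiag_ann e"
  by (auto simp: offdiag_ann_def)

lemma delta_add_opposite_corner_offdiag:
  assumes "c \<in> A" "e * c = 0" "c * e = 0" "b \<in> offdiag"
  shows "\<delta> (c + b) - (\<delta> c + \<delta> b) \<in> offdiag_ann e"
  using compl.delta_add_corner_offdiag[of c b] assms
  by (simp add: compl_offdiag compl_ann left_diff_distrib right_diff_distrib)

text \<open>In \<open>2 jp (e + x) (1 - e + y) = x + y + 2 jp x y\<close> the last term has no off-diagonal part, and the two
factors on the left are sums to which the previous lemmas apply. The congruence obtained is an
equation, because both sides are off-diagonal.\<close>
lemma delta_add_offdiag:
  assumes x: "x \<in> offdiag" and y: "y \<in> offdiag"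
  shows "\<delta> (x + y) = \<delta> x + \<delta> y"
proof -
  note xA = offdiag_mem[OF x] and yA = offdiag_mem[OF y]
  let ?T = "2 *\<^sub>R jp (e + x) ((1 - e) + y)"
  have T: "?T = x + y + 2 *\<^sub>R jp x y"
  proof -
    have "jp e (1 - e) = 0" by (simp add: jp_def algebra_simps ee)
    then have "jp (e + x) ((1 - e) + y) = (1/2) *\<^sub>R x + (1/2) *\<^sub>R y + jp x y"
      using jp_peirce_left[OF x] jp_e_offdiag[OF y]
      by (simp add: jp_add_left jp_add_right jp_commute[of x "1 - e"])
    then show ?thesis by (simp add: scaleR_add_right)
  qed
  define p where "p = \<delta> (e + x) - \<delta> x"
  define q where "q = \<delta> ((1 - e) + y) - \<delta> y"
  have p: "p \<in> offdiag_ann e" using delta_add_corner_offdiag[of e x] x by (simp add: p_def ee)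
  have q: "q \<in> offdiag_ann e"
    using delta_add_opposite_corner_offdiag[of "1 - e" y] y by (simp add: q_def algebra_simps ee)
  have "\<delta> ?T = 2 *\<^sub>R (jp (\<delta> x + p) ((1 - e) + y) + jp (e + x) (\<delta> y + q))"
    using xA yA by (simp add: delta_scale_two jordan_rule p_def q_def)
  also have "\<dots> = 2 *\<^sub>R (jp (\<delta> x) (1 - e) + jp (\<delta> x) y + jp e (\<delta> y) + jp x (\<delta> y))
      + 2 *\<^sub>R (jp p ((1 - e) + y) + jp (e + x) q)"
    by (simp add: jp_add_left jp_add_right scaleR_add_right)
  also have "jp (\<delta> x) (1 - e) = (1/2) *\<^sub>R \<delta> x"
    using jp_peirce_left delta_offdiag x by (simp add: jp_commute)
  also have "jp e (\<delta> y) = (1/2) *\<^sub>R \<delta> y"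
    using jp_e_offdiag delta_offdiag y by simp
  finally have 1: "\<delta> ?T = \<delta> x + \<delta> y + 2 *\<^sub>R (jp (\<delta> x) y + jp x (\<delta> y))
      + 2 *\<^sub>R (jp p ((1 - e) + y) + jp (e + x) q)"
    by (simp add: scaleR_add_right)
  let ?n = "2 *\<^sub>R (jp p ((1 - e) + y) + jp (e + x) q)"
  have n: "?n \<in> offdiag_ann e"
    using p q xA yA
    by (intro offdiag_ann_scaleR offdiag_ann_add offdiag_ann_jp_left offdiag_ann_jp_right) auto
  have "\<delta> (off_part ?T) = off_part (\<delta> ?T)"
    using xA yA by (intro off_part_delta[symmetric]) auto
  also have "off_part ?T = x + y"
    unfolding T by (simp add: off_part_add off_part_scaleR off_part_jp_offdiag off_part_id x y)
  also have "off_part (\<delta> ?T) = \<delta> x + \<delta> y + off_part ?n"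
    unfolding 1
    by (simp add: off_part_add off_part_scaleR off_part_jp_offdiag off_part_id x y delta_offdiag)
  finally have 2: "\<delta> (x + y) = \<delta> x + \<delta> y + off_part ?n" .
  have "?n \<in> A" using n by (rule offdiag_ann_subset)
  then have "off_part ?n = 0"
    using n by (intro offdiag_ann_offdiag offdiag_ann_off_part off_part_offdiag)
  with 2 show ?thesis by simp
qed

text \<open>Multiplication by off-diagonal \<open>r\<close> moves corner elements into the off-diagonal space, where
additivity is known exactly.\<close>
lemma delta_add_corner:
  assumes a: "a \<in> A" "e * a = a" "a * e = a" and b: "b \<in> A" "e * b = b" "b * e = b"
  shows "\<delta> (a + b) - (\<delta> a + \<delta> b) \<in> offdiag_ann e"
proof (rule offdiag_annI)
  have ab: "a + b \<in> A" "e * (a + b) = a + b" "(a + b) * e = a + b"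
    using a b by (simp_all add: distrib_left distrib_right)
  show "\<delta> (a + b) - (\<delta> a + \<delta> b) \<in> A" using ab a b by auto
  show "e * (\<delta> (a + b) - (\<delta> a + \<delta> b)) = \<delta> (a + b) - (\<delta> a + \<delta> b)"
    "(\<delta> (a + b) - (\<delta> a + \<delta> b)) * e = \<delta> (a + b) - (\<delta> a + \<delta> b)"
    by (simp_all only: left_diff_distrib right_diff_distrib distrib_left distrib_right
        delta_corner[OF a] delta_corner[OF b] delta_corner[OF ab])
  fix r assume r: "r \<in> offdiag"
  note rA = offdiag_mem[OF r]
  have "\<delta> (jp r (a + b)) = \<delta> (jp r a) + \<delta> (jp r b)"
    unfolding jp_add_right
    using a b r by (intro delta_add_offdiag corner_jp_offdiag)
  moreover have "\<delta> (jp r (a + b)) = jp (\<delta> r) a + jp (\<delta> r) b + jp r (\<delta> (a + b))"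
    using rA ab by (simp add: jordan_rule flip: jp_add_right)
  ultimately have "jp r (\<delta> (a + b) - (\<delta> a + \<delta> b)) = 0"
    using rA a b by (simp add: jordan_rule jp_add_right jp_diff_right)
  then show "jp (\<delta> (a + b) - (\<delta> a + \<delta> b)) r = 0" by (simp add: jp_commute)
qed

end

context jordan_multiplicative_at
begin

interpretation compl: jordan_multiplicative_at A \<delta> "1 - e"
  by (rule complementary)

lemma delta_add_opposite_corner:
  assumes "a \<in> A" "e * a = 0" "a * e = 0" "b \<in> A" "e * b = 0" "b * e = 0"
  shows "\<delta> (a + b) - (\<delta> a + \<delta> b) \<in> offdiag_ann e"
  using compl.delta_add_corner[of a b] assms
  by (simp add: compl_ann left_diff_distrib right_diff_distrib)

lemma delta_corner_part:
  assumes x: "x \<in> A"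
  shows "e * \<delta> x * e - \<delta> (e * x * e) \<in> offdiag_ann e"
proof -
  let ?a = "e * x * e" and ?b = "(1/2) *\<^sub>R off_part x" and ?y = "\<delta> x"
  have j: "jp e x = e * x * e + (1/2) *\<^sub>R off_part x" for x
  proof -
    have "2 *\<^sub>R (e * x * e + (1/2) *\<^sub>R off_part x) = e * x + x * e"
      by (simp add: off_part_def scaleR_add_right scaleR_2)
    then have "jp e x = (1/2) *\<^sub>R (2 *\<^sub>R (e * x * e + (1/2) *\<^sub>R off_part x))"
      by (simp only: jp_def)
    then show ?thesis by simp
  qed
  have "\<delta> (?a + ?b) = jp e ?y" using jordan_rule[of e x] x unfolding j by simp
  also have "\<dots> = e * ?y * e + (1/2) *\<^sub>R off_part ?y" by (rule j)
  also have "\<dots> = e * ?y * e + \<delta> ?b"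
    using x by (simp add: delta_scale_half off_part_delta)
  finally have "e * ?y * e - \<delta> ?a = \<delta> (?a + ?b) - (\<delta> ?a + \<delta> ?b)" by simp
  also have "\<dots> \<in> offdiag_ann e"
    using x by (intro delta_add_corner_offdiag offdiag_scaleR off_part_offdiag)
      (auto simp: mult.assoc ee eex)
  finally show ?thesis .
qed

end

context jordan_multiplicative_at
begin

interpretation compl: jordan_multiplicative_at A \<delta> "1 - e"
  by (rule complementary)

lemma delta_opposite_corner_part:
  assumes x: "x \<in> A"
  shows "(1 - e) * \<delta> x * (1 - e) - \<delta> ((1 - e) * x * (1 - e)) \<in> offdiag_ann e"
  using compl.delta_corner_part[OF x] by (simp add: compl_ann)

text \<open>Modulo the annihilator, \<open>\<delta>\<close> is the sum of its restrictions to the three Peirce spaces, and it is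
additive on each of them. Here \<open>A1\<close> and \<open>A0\<close> are the errors in the two corners, and \<open>D1\<close> and \<open>D0\<close>
the deviations from additivity there.\<close>
lemma delta_add_at:
  assumes x: "x \<in> A" and y: "y \<in> A"
  shows "\<delta> (x + y) - (\<delta> x + \<delta> y) \<in> offdiag_ann e"
proof -
  have peirce: "t = e * t * e + off_part t + (1 - e) * t * (1 - e)" for t
    by (simp add: off_part_def algebra_simps)
  let ?f = "1 - e"
  define A1 where "A1 t = e * \<delta> t * e - \<delta> (e * t * e)" for t
  define A0 where "A0 t = ?f * \<delta> t * ?f - \<delta> (?f * t * ?f)" for t
  define D1 where "D1 = \<delta> (e * x * e + e * y * e) - (\<delta> (e * x * e) + \<delta> (e * y * e))"
  define D0 where "D0 = \<delta> (?f * x * ?f + ?f * y * ?f) - (\<delta> (?f * x * ?f) + \<delta> (?f * y * ?f))"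
  have ann: "A1 t \<in> offdiag_ann e" "A0 t \<in> offdiag_ann e" if "t \<in> A" for t
    unfolding A1_def A0_def using that by (rule delta_corner_part delta_opposite_corner_part)+
  have D1: "D1 \<in> offdiag_ann e"
    unfolding D1_def using x y by (intro delta_add_corner) (auto simp: mult.assoc ee eex)
  have D0: "D0 \<in> offdiag_ann e"
    unfolding D0_def using x y
    by (intro delta_add_opposite_corner) (auto simp: algebra_simps ee eex)
  have dec: "\<delta> t = \<delta> (e * t * e) + A1 t + \<delta> (off_part t) + (\<delta> (?f * t * ?f) + A0 t)"
    if "t \<in> A" for t
    using peirce[of "\<delta> t"] off_part_delta[OF that] by (simp add: A1_def A0_def)
  have off: "\<delta> (off_part (x + y)) = \<delta> (off_part x) + \<delta> (off_part y)"
    unfolding off_part_add using x y by (intro delta_add_offdiag off_part_offdiag)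
  have corner: "\<delta> (e * (x + y) * e) = D1 + (\<delta> (e * x * e) + \<delta> (e * y * e))"
    unfolding D1_def distrib_left distrib_right by simp
  have opposite: "\<delta> (?f * (x + y) * ?f) = D0 + (\<delta> (?f * x * ?f) + \<delta> (?f * y * ?f))"
    unfolding D0_def distrib_left distrib_right by simp
  have "\<delta> (x + y) - (\<delta> x + \<delta> y)
      = D1 + D0 + (A1 (x + y) + A0 (x + y)) - (A1 x + A0 x) - (A1 y + A0 y)"
    unfolding dec[OF add_mem[OF x y]] off corner opposite dec[OF x] dec[OF y] by (simp only: algebra_simps)
  also have "\<dots> \<in> offdiag_ann e"
    using x y ann D1 D0
    by (intro offdiag_ann_add offdiag_ann_diff) auto
  finally show ?thesis .
qed

end

text \<open>The deviation from additivity is the same for \<open>\<delta>\<close> and for the map normalized at \<open>e\<close>; so it lies in the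
annihilators belonging to all idempotents.\<close>
theorem (in jordan_multiplicative) delta_additive:
  assumes "x \<in> A" "y \<in> A"
  shows "\<delta> (x + y) = \<delta> x + \<delta> y"
proof -
  have "\<delta> (x + y) - (\<delta> x + \<delta> y) = 0"
  proof (rule offdiag_ann_Inter)
    fix e assume e: "e \<in> A" "e * e = e"
    then obtain w where "jordan_multiplicative_at A (\<lambda>x. \<delta> x - (x * w - w * x)) e"
      using normalise_at by metis
    from jordan_multiplicative_at.delta_add_at[OF this assms]
    show "\<delta> (x + y) - (\<delta> x + \<delta> y) \<in> offdiag_ann e"
      by (simp add: algebra_simps)
  qed (use assms in auto)
  then show ?thesis by simp
qed

section \<open>Additive Jordan derivations are derivations\<close>

context semiprime_with_idempotents
begin

text \<open>Applying the skew symmetry three times to the word \<open>a x b y a x b\<close> reproduces it with the opposite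
sign.\<close>
lemma semiprime_skew:
  assumes a: "a \<in> A" and b: "b \<in> A" and skew: "\<And>x. x \<in> A \<Longrightarrow> a * x * b + b * x * a = 0"
    and x: "x \<in> A"
  shows "a * x * b = 0"
proof (rule semiprime)
  show "a * x * b \<in> A" using a b x by auto
  fix y assume y: "y \<in> A"
  have s: "a * t * b = - (b * t * a)" if "t \<in> A" for t
    using skew[OF that] by (simp add: eq_neg_iff_add_eq_0)
  let ?p = "a * x * b * y * (a * x * b)"
  have "?p = - (b * x * a * y * (a * x * b))"
    using s[OF x] by (metis minus_mult_left)
  also have "\<dots> = - (b * (x * a * y) * a * (x * b))"
    by (simp add: mult.assoc)
  also have "\<dots> = a * (x * a * y) * b * (x * b)"
    using s[of "x * a * y"] a x y by simp
  also have "\<dots> = a * x * (a * y * b) * x * b"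
    by (simp add: mult.assoc)
  also have "\<dots> = - (a * x * (b * y * a) * x * b)"
    using s[OF y] by simp
  also have "\<dots> = - ?p"
    by (simp add: mult.assoc)
  finally have "?p + ?p = 0 + 0" by (simp add: eq_neg_iff_add_eq_0)
  then show "?p = 0" by (rule double_cancel)
qed

text \<open>Polarizing \<open>w a x k a = 0\<close> gives \<open>w a x k c = - w c x k a\<close>; a product of two such elements contains
\<open>w a (\<dots>) k a\<close> and vanishes.\<close>
lemma semiprime_linearize:
  assumes w: "\<And>a. a \<in> A \<Longrightarrow> w a \<in> A" "\<And>a c. a \<in> A \<Longrightarrow> c \<in> A \<Longrightarrow> w (a + c) = w a + w c"
    and k: "\<And>a. a \<in> A \<Longrightarrow> k a \<in> A" "\<And>a c. a \<in> A \<Longrightarrow> c \<in> A \<Longrightarrow> k (a + c) = k a + k c"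
    and orth: "\<And>a x. a \<in> A \<Longrightarrow> x \<in> A \<Longrightarrow> w a * x * k a = 0"
    and a: "a \<in> A" and c: "c \<in> A" and x: "x \<in> A"
  shows "w a * x * k c = 0"
proof (rule semiprime)
  show "w a * x * k c \<in> A" using w k a c x by auto
  fix y assume y: "y \<in> A"
  have "w (a + c) * x * k (a + c) = w a * x * k c + w c * x * k a"
    using a c x w k orth by (simp add: distrib_left distrib_right)
  then have "w a * x * k c + w c * x * k a = 0" using orth a c x by simp
  then have "w a * x * k c = - (w c * x * k a)" by (simp add: eq_neg_iff_add_eq_0)
  then have "w a * x * k c * y * (w a * x * k c) = w a * x * k c * y * - (w c * x * k a)"
    by (rule arg_cong)
  also have "\<dots> = - (w a * (x * k c * y * w c * x) * k a)" by (simp add: mult.assoc)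
  also have "\<dots> = 0" using orth[OF a, of "x * k c * y * w c * x"] w k a c x y by simp
  finally show "w a * x * k c * y * (w a * x * k c) = 0" .
qed

end

context jordan_multiplicative
begin

lemma delta_add [simp]: "x \<in> A \<Longrightarrow> y \<in> A \<Longrightarrow> \<delta> (x + y) = \<delta> x + \<delta> y"
  by (rule delta_additive)

lemma delta_anticommutator:
  assumes "x \<in> A" "y \<in> A"
  shows "\<delta> (x * y + y * x) = \<delta> x * y + y * \<delta> x + (x * \<delta> y + \<delta> y * x)"
  using jordan_rule_double[OF assms] assms by (metis delta_add jp_double jp_mem)

text \<open>The identity \<open>2 a b a = a \<circ> (a \<circ> b) - a\<^sup>2 \<circ> b\<close>, with \<open>x \<circ> y = x y + y x\<close>, expresses the sandwich by
anticommutators.\<close>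
lemma delta_sandwich:
  assumes a: "a \<in> A" and b: "b \<in> A"
  shows "\<delta> (a * b * a) = \<delta> a * b * a + a * \<delta> b * a + a * b * \<delta> a"
proof (rule double_cancel)
  have "a * b * a + a * b * a + ((a * a) * b + b * (a * a)) = a * (a * b + b * a) + (a * b + b * a) * a"
    by (simp add: algebra_simps)
  then have "\<delta> (a * b * a + a * b * a + ((a * a) * b + b * (a * a))) = \<delta> (a * (a * b + b * a) + (a * b + b * a) * a)"
    by (rule arg_cong)
  moreover have "\<delta> (a * a) = \<delta> a * a + a * \<delta> a"
    using delta_anticommutator[OF a a] a by - (rule double_cancel, simp add: algebra_simps)
  ultimately have "\<delta> (a * b * a) + \<delta> (a * b * a) + ((\<delta> a * a + a * \<delta> a) * b + b * (\<delta> a * a + a * \<delta> a) + (a * a * \<delta> b + \<delta> b * (a * a)))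
    = \<delta> a * (a * b + b * a) + (a * b + b * a) * \<delta> a + (a * (\<delta> a * b + b * \<delta> a + (a * \<delta> b + \<delta> b * a)) + (\<delta> a * b + b * \<delta> a + (a * \<delta> b + \<delta> b * a)) * a)"
    using a b delta_anticommutator[of "a * a" b] delta_anticommutator[of a "a * b + b * a"]
      delta_anticommutator[of a b]
    by (simp only: delta_add[of "a * b * a + a * b * a" "a * a * b + b * (a * a)"]
        delta_add[of "a * b * a" "a * b * a"] add_mem mult_mem)
  then show "\<delta> (a * b * a) + \<delta> (a * b * a) = \<delta> a * b * a + a * \<delta> b * a + a * b * \<delta> a + (\<delta> a * b * a + a * \<delta> b * a + a * b * \<delta> a)"
    by (simp add: algebra_simps)
qed

lemma delta_triple:
  assumes a: "a \<in> A" and b: "b \<in> A" and c: "c \<in> A"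
  shows "\<delta> (a * b * c + c * b * a)
    = \<delta> a * b * c + a * \<delta> b * c + a * b * \<delta> c + (\<delta> c * b * a + c * \<delta> b * a + c * b * \<delta> a)"
proof -
  have "(a + c) * b * (a + c) = a * b * a + (a * b * c + c * b * a) + c * b * c"
    by (simp add: algebra_simps)
  then have "\<delta> ((a + c) * b * (a + c)) = \<delta> (a * b * a) + \<delta> (a * b * c + c * b * a) + \<delta> (c * b * c)"
    using a b c by simp
  then have "\<delta> (a * b * c + c * b * a) = \<delta> ((a + c) * b * (a + c)) - \<delta> (a * b * a) - \<delta> (c * b * c)"
    by simp
  also have "\<dots> = \<delta> a * b * c + a * \<delta> b * c + a * b * \<delta> c + (\<delta> c * b * a + c * \<delta> b * a + c * b * \<delta> a)"
    using a b c by (simp add: delta_sandwich del: delta_add) (simp add: algebra_simps)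
  finally show ?thesis .
qed

text \<open>The failure of the Leibniz rule for the associative product.\<close>
definition defect :: "'a \<Rightarrow> 'a \<Rightarrow> 'a"
  where "defect a b = \<delta> (a * b) - \<delta> a * b - a * \<delta> b"

lemma defect_mem [simp, intro]: "a \<in> A \<Longrightarrow> b \<in> A \<Longrightarrow> defect a b \<in> A"
  by (auto simp: defect_def)

lemma defect_add_left: "a \<in> A \<Longrightarrow> b \<in> A \<Longrightarrow> c \<in> A \<Longrightarrow> defect (a + c) b = defect a b + defect c b"
  and defect_add_right: "a \<in> A \<Longrightarrow> b \<in> A \<Longrightarrow> c \<in> A \<Longrightarrow> defect a (b + c) = defect a b + defect a c"
  by (simp_all add: defect_def distrib_left distrib_right)

lemma defect_skew:
  assumes "a \<in> A" "b \<in> A"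
  shows "defect b a = - defect a b"
proof -
  have "\<delta> (a * b) + \<delta> (b * a) = \<delta> a * b + b * \<delta> a + (a * \<delta> b + \<delta> b * a)"
    using delta_anticommutator[OF assms] assms by simp
  then have "defect b a + defect a b = 0" by (simp add: defect_def algebra_simps)
  then show ?thesis by (simp add: eq_neg_iff_add_eq_0)
qed

text \<open>The element \<open>a (b x b) a + b (a x a) b = (a b) x (b a) + (b a) x (a b)\<close> is differentiated in two ways:
by two nested sandwiches on the left, and as a triple with outer factors \<open>a b\<close> and \<open>b a\<close> on the
right. The difference of the results is the assertion.\<close>
lemma defect_commutator_skew:
  assumes a: "a \<in> A" and b: "b \<in> A" and x: "x \<in> A"
  shows "defect a b * x * (a * b - b * a) + (a * b - b * a) * x * defect a b = 0"
proof -
  let ?s = "\<delta> (a * b * x * (b * a) + b * a * x * (a * b))"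
  have "?s = \<delta> (a * (b * x * b) * a + b * (a * x * a) * b)"
    by (simp add: mult.assoc)
  also have "\<dots> = \<delta> a * (b * x * b) * a + a * (\<delta> b * x * b + b * \<delta> x * b + b * x * \<delta> b) * a + a * (b * x * b) * \<delta> a
     + (\<delta> b * (a * x * a) * b + b * (\<delta> a * x * a + a * \<delta> x * a + a * x * \<delta> a) * b + b * (a * x * a) * \<delta> b)"
    using a b x by (simp add: delta_sandwich)
  finally have 1: "?s = \<dots>" .
  have ab: "\<delta> (a * b) = defect a b + (\<delta> a * b + a * \<delta> b)"
    and ba: "\<delta> (b * a) = (\<delta> b * a + b * \<delta> a) - defect a b"
    using defect_skew[OF a b] by (simp_all add: defect_def algebra_simps)
  have "?s = \<delta> (a * b) * x * (b * a) + a * b * \<delta> x * (b * a) + a * b * x * \<delta> (b * a)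
     + (\<delta> (b * a) * x * (a * b) + b * a * \<delta> x * (a * b) + b * a * x * \<delta> (a * b))"
    using a b x by (intro delta_triple) auto
  from trans[OF this[symmetric] 1]
  show ?thesis unfolding ab ba
    by (simp add: algebra_simps)
qed

text \<open>Semiprimeness turns the previous identity into \<open>defect a b x [a, b] = 0\<close>, and polarization in both
arguments into \<open>defect a b x [c, d] = 0\<close> for arbitrary \<open>c\<close> and \<open>d\<close>; so the defect annihilates the
commutators with idempotents.\<close>
theorem delta_derivation:
  assumes a: "a \<in> A" and b: "b \<in> A"
  shows "\<delta> (a * b) = \<delta> a * b + a * \<delta> b"
proof -
  have 1: "defect a b * x * (a * b - b * a) = 0" if "a \<in> A" "b \<in> A" "x \<in> A" for a b x
    using that by (intro semiprime_skew defect_commutator_skew) auto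
  have 2: "defect a b * x * (c * b - b * c) = 0" if "a \<in> A" "b \<in> A" "c \<in> A" "x \<in> A" for a b c x
    by (rule semiprime_linearize[of "\<lambda>a. defect a b" "\<lambda>a. a * b - b * a"])
       (use that in \<open>((simp add: 1 defect_add_left; fail) | (simp add: algebra_simps; fail))+\<close>)
  have 3: "defect a b * x * (c * d - d * c) = 0" if "a \<in> A" "b \<in> A" "c \<in> A" "d \<in> A" "x \<in> A" for a b c d x
    by (rule semiprime_linearize[of "\<lambda>b. defect a b" "\<lambda>b. c * b - b * c"])
       (use that in \<open>((simp add: 2 defect_add_right; fail) | (simp add: algebra_simps; fail))+\<close>)
  have "defect a b = 0"
    by (rule idempotents_faithful) (use a b 3 in auto)
  then show ?thesis by (simp add: defect_def algebra_simps)
qed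

end

section \<open>Twisted Jordan derivations and Jordan multipliers\<close>

context semiprime_with_idempotents
begin

text \<open>This rule is what remains of an \<open>n\<close>-fold Jordan derivation when all but two arguments are \<open>1\<close>. For an
idempotent \<open>e\<close> it expresses \<open>e (\<delta> 1) + (\<delta> 1) e\<close> through \<open>\<delta> e\<close> in such a way that the off-diagonal parts
of \<open>\<delta> e\<close> cancel; thus \<open>\<delta> 1\<close> has no off-diagonal part, that is, it commutes with \<open>e\<close>.\<close>
theorem twisted_jordan_derivation:
  fixes \<delta> :: "'a \<Rightarrow> 'a"
  assumes maps: "\<And>x. x \<in> A \<Longrightarrow> \<delta> x \<in> A"
    and rule: "\<And>x y. x \<in> A \<Longrightarrow> y \<in> A \<Longrightarrow> \<delta> (jp x y) = jp (\<delta> x) y + jp x (\<delta> y) - jp (jp x y) (\<delta> 1)"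
  shows "x \<in> A \<Longrightarrow> \<delta> 1 * x = x * \<delta> 1"
    and "jordan_multiplicative A (\<lambda>x. \<delta> x - \<delta> 1 * x)"
proof -
  let ?d = "\<delta> 1"
  have dA: "?d \<in> A" by (simp add: maps)
  show c: "?d * x = x * ?d" if "x \<in> A" for x
  proof (rule commutes_idempotents_central[OF dA _ that])
    fix e assume e: "e \<in> A" "e * e = e"
    have ee: "e * (e * x) = e * x" for x by (metis e(2) mult.assoc)
    have "jp e e = e" by (rule double_cancel) (simp add: jp_double e)
    then have "\<delta> e = jp (\<delta> e) e + jp e (\<delta> e) - jp e ?d" using rule[of e e] e by simp
    then have s: "\<delta> e + jp e ?d = jp (\<delta> e) e + jp e (\<delta> e)" by (metis diff_add_cancel)
    have "\<delta> e + \<delta> e + (jp e ?d + jp e ?d) = (\<delta> e + jp e ?d) + (\<delta> e + jp e ?d)"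
      by (simp add: ac_simps)
    also have "\<dots> = (jp (\<delta> e) e + jp (\<delta> e) e) + (jp e (\<delta> e) + jp e (\<delta> e))"
      unfolding s by (simp add: ac_simps)
    finally have 1: "\<delta> e + \<delta> e + (e * ?d + ?d * e) = (\<delta> e * e + e * \<delta> e) + (e * \<delta> e + \<delta> e * e)"
      unfolding jp_double .
    have "e * (\<delta> e + \<delta> e + (e * ?d + ?d * e)) * (1 - e) = e * ((\<delta> e * e + e * \<delta> e) + (e * \<delta> e + \<delta> e * e)) * (1 - e)"
      by (simp only: 1)
    then have 2: "e * ?d = e * ?d * e" by (simp add: algebra_simps ee e)
    have "(1 - e) * (\<delta> e + \<delta> e + (e * ?d + ?d * e)) * e = (1 - e) * ((\<delta> e * e + e * \<delta> e) + (e * \<delta> e + \<delta> e * e)) * e"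
      by (simp only: 1)
    then have 3: "?d * e = e * ?d * e" by (simp add: algebra_simps ee e)
    show "?d * e = e * ?d" by (rule trans[OF 3 2[symmetric]])
  qed
  show "jordan_multiplicative A (\<lambda>x. \<delta> x - ?d * x)"
  proof unfold_locales
    fix x y assume x: "x \<in> A" and y: "y \<in> A"
    have l: "jp (?d * x) y = ?d * jp x y"
      using c[OF y] by (simp add: jp_def distrib_left) (metis mult.assoc)
    have r: "jp x (?d * y) = ?d * jp x y"
      using c[OF x] by (simp add: jp_def distrib_left) (metis mult.assoc)
    have "jp (jp x y) ?d = ?d * jp x y"
      using c[of "jp x y"] x y by - (rule double_cancel, simp add: jp_double)
    then show "\<delta> (jp x y) - ?d * jp x y = jp (\<delta> x - ?d * x) y + jp x (\<delta> y - ?d * y)"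
      by (simp add: rule x y jp_diff_left jp_diff_right l r)
  qed (use maps dA in auto)
qed

text \<open>With \<open>x = 1\<close> the rule gives \<open>\<phi> y = jp m y\<close> for \<open>m = \<phi> 1\<close>, and symmetry of \<open>jp x y\<close> then says that \<open>m\<close>
commutes with all commutators. From \<open>[x, y x] = [x, y] x\<close> follows \<open>[x, y] [m, x] = 0\<close>; taking \<open>y\<close> to
be \<open>z\<close> and \<open>m z\<close> leads to \<open>[m, x] z [m, x] = 0\<close>, so \<open>m\<close> is central by semiprimeness.\<close>
theorem jordan_multiplier:
  fixes \<phi> :: "'a \<Rightarrow> 'a"
  assumes maps: "\<And>x. x \<in> A \<Longrightarrow> \<phi> x \<in> A"
    and rule: "\<And>x y. x \<in> A \<Longrightarrow> y \<in> A \<Longrightarrow> \<phi> (jp x y) = jp (\<phi> x) y"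
  shows "x \<in> A \<Longrightarrow> \<phi> 1 * x = x * \<phi> 1" and "x \<in> A \<Longrightarrow> \<phi> x = \<phi> 1 * x"
proof -
  let ?m = "\<phi> 1"
  have mA: "?m \<in> A" by (simp add: maps)
  have phi: "\<phi> x = jp ?m x" if "x \<in> A" for x using rule[of 1 x] that by simp
  have cc: "?m * (x * y - y * x) = (x * y - y * x) * ?m" if x: "x \<in> A" and y: "y \<in> A" for x y
  proof -
    have "jp (jp ?m x) y = jp (jp ?m y) x"
      using rule[OF x y] rule[OF y x] x y unfolding phi[OF x] phi[OF y] by (simp add: jp_commute[of x y])
    moreover have "jp (jp ?m u) v = (1/4) *\<^sub>R ((?m * u + u * ?m) * v + v * (?m * u + u * ?m))" for u v
      by (simp add: jp_def algebra_simps)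
    ultimately have "(?m * x + x * ?m) * y + y * (?m * x + x * ?m) = (?m * y + y * ?m) * x + x * (?m * y + y * ?m)"
      by (simp only: scaleR_cancel_left) simp
    then show ?thesis by (simp add: algebra_simps)
  qed
  show central: "?m * x = x * ?m" if x: "x \<in> A" for x
  proof -
    define c where "c = ?m * x - x * ?m"
    have ann: "(x * y - y * x) * c = 0" if y: "y \<in> A" for y
    proof -
      have "(x * y - y * x) * c = (?m * (x * (y * x) - y * x * x) - (x * (y * x) - y * x * x) * ?m)
          - (?m * (x * y - y * x) - (x * y - y * x) * ?m) * x"
        by (simp add: c_def algebra_simps)
      then show ?thesis using cc[OF x y] cc[OF x, of "y * x"] x y by simp
    qed
    have "c = 0"
    proof (rule semiprime)
      show "c \<in> A" using x mA by (simp add: c_def)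
      fix z assume z: "z \<in> A"
      have "c * z * c = ?m * ((x * z - z * x) * c) - (x * (?m * z) - ?m * z * x) * c"
        by (simp add: c_def algebra_simps)
      then show "c * z * c = 0" using ann[OF z] ann[of "?m * z"] z mA by simp
    qed
    then show ?thesis by (simp add: c_def)
  qed
  show "\<phi> x = ?m * x" if "x \<in> A" for x
    using central[OF that] phi[OF that] by - (rule double_cancel, simp add: jp_double)
qed

end

section \<open>Bounded operators as an algebra\<close>

text \<open>A copy of the bounded operators whose multiplication is composition, so that the lemmas on algebras
apply.\<close>
typedef (overloaded) 'h endo = "UNIV :: ('h :: real_normed_vector \<Rightarrow>\<^sub>L 'h) set"
  morphisms op_of endo_of ..

setup_lifting type_definition_endo

instantiation endo :: (real_normed_vector) real_unital_algebra
begin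

lift_definition zero_endo :: "'a endo" is 0 .
lift_definition one_endo :: "'a endo" is id_blinfun .
lift_definition plus_endo :: "'a endo \<Rightarrow> 'a endo \<Rightarrow> 'a endo" is "(+)" .
lift_definition minus_endo :: "'a endo \<Rightarrow> 'a endo \<Rightarrow> 'a endo" is "(-)" .
lift_definition uminus_endo :: "'a endo \<Rightarrow> 'a endo" is uminus .
lift_definition times_endo :: "'a endo \<Rightarrow> 'a endo \<Rightarrow> 'a endo" is "(o\<^sub>L)" .
lift_definition scaleR_endo :: "real \<Rightarrow> 'a endo \<Rightarrow> 'a endo" is "scaleR" .

instance
  by standard
    (rule op_of_inject[THEN iffD1], rule blinfun_eqI,
      simp add: zero_endo.rep_eq one_endo.rep_eq plus_endo.rep_eq minus_endo.rep_eq uminus_endo.rep_eq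
        times_endo.rep_eq scaleR_endo.rep_eq blinfun.bilinear_simps scaleR_add_left scaleR_add_right)+

end

lift_definition ap :: "'h :: real_normed_vector endo \<Rightarrow> 'h \<Rightarrow> 'h" is blinfun_apply .

lemma endo_eqI: "(\<And>v. ap S v = ap T v) \<Longrightarrow> S = T"
  by (simp add: ap.rep_eq blinfun_eqI flip: op_of_inject)

lemma ap_simps [simp]:
  "ap 0 v = 0" "ap 1 v = v" "ap (S + T) v = ap S v + ap T v" "ap (S - T) v = ap S v - ap T v"
  "ap (- T) v = - ap T v" "ap (S * T) v = ap S (ap T v)" "ap (r *\<^sub>R T) v = r *\<^sub>R ap T v"
  by (simp_all add: ap.rep_eq zero_endo.rep_eq one_endo.rep_eq plus_endo.rep_eq minus_endo.rep_eq
      uminus_endo.rep_eq times_endo.rep_eq scaleR_endo.rep_eq blinfun.bilinear_simps)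

lemma ap_linear [simp]:
  "ap T 0 = 0" "ap T (v + w) = ap T v + ap T w" "ap T (v - w) = ap T v - ap T w"
  "ap T (- v) = - ap T v" "ap T (r *\<^sub>R v) = r *\<^sub>R ap T v"
  by (simp_all add: ap.rep_eq blinfun.bilinear_simps)

lemma ap_bound: "norm (ap T v) \<le> norm (op_of T) * norm v"
  unfolding ap.rep_eq by (rule norm_blinfun)

lemma ap_tendsto: "(f \<longlongrightarrow> l) F \<Longrightarrow> ((\<lambda>n. ap T (f n)) \<longlongrightarrow> ap T l) F"
  unfolding ap.rep_eq by (rule blinfun.tendsto[OF tendsto_const])

section \<open>Self-adjoint operators\<close>

text \<open>A symmetric real bilinear form. It determines the inner product, whose imaginary part at \<open>v\<close> and \<open>w\<close> is
the real part at \<open>- \<i> v\<close> and \<open>w\<close>.\<close>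
definition ip :: "'h :: chilbert_space \<Rightarrow> 'h \<Rightarrow> real"
  where "ip x y = Re (cinner x y)"

lemma ip_commute: "ip x y = ip y x"
  unfolding ip_def by (subst cinner_commute) simp

lemma ip_add_left: "ip (x + y) z = ip x z + ip y z"
  by (simp add: ip_def cinner_add_left)

lemma ip_scaleR_left: "ip (r *\<^sub>R x) y = r * ip x y"
  by (simp add: ip_def scaleR_scaleC cinner_scaleC_left)

lemma ip_minus_left: "ip (- x) y = - ip x y"
  using ip_scaleR_left[of "-1" x y] by simp

lemma ip_diff_left: "ip (x - y) z = ip x z - ip y z"
  using ip_add_left[of x "- y" z] by (simp add: ip_minus_left)

lemma ip_add_right: "ip z (x + y) = ip z x + ip z y"
  and ip_scaleR_right: "ip y (r *\<^sub>R x) = r * ip y x"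
  and ip_minus_right: "ip y (- x) = - ip y x"
  and ip_diff_right: "ip z (x - y) = ip z x - ip z y"
  using ip_add_left[of x y z] ip_scaleR_left[of r x y] ip_minus_left[of x y] ip_diff_left[of x y z]
  by (simp_all only: ip_commute)

lemmas ip_simps = ip_add_left ip_add_right ip_scaleR_left ip_scaleR_right ip_minus_left
  ip_minus_right ip_diff_left ip_diff_right

lemma ip_zero [simp]: "ip 0 x = 0" "ip x 0 = 0"
  using ip_scaleR_left[of 0 0 x] ip_scaleR_right[of x 0 0] by simp_all

lemma ip_self: "ip x x = (norm x)\<^sup>2"
  by (simp add: ip_def cinner_eq_norm)

lemma norm_add_sq: "(norm (x + y))\<^sup>2 = (norm x)\<^sup>2 + 2 * ip x y + (norm (y :: 'h :: chilbert_space))\<^sup>2"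
  unfolding ip_self[symmetric] by (simp add: ip_simps ip_commute[of y x])

lemma norm_diff_sq: "(norm (x - y))\<^sup>2 = (norm x)\<^sup>2 - 2 * ip x y + (norm (y :: 'h :: chilbert_space))\<^sup>2"
  unfolding ip_self[symmetric] by (simp add: ip_simps ip_commute[of y x])

lemma norm_diff_half_scaled:
  fixes x y :: "'h :: chilbert_space"
  shows "(norm (x - (r/2) *\<^sub>R y))\<^sup>2 = (norm x)\<^sup>2 - r * ip x y + r * r * (norm y)\<^sup>2 / 4"
  by (simp add: norm_diff_sq ip_scaleR_right power_mult_distrib power_divide) (simp add: power2_eq_square)

lemma ip_polarization: "ip x y = ((norm (x + y))\<^sup>2 - (norm (x - y))\<^sup>2) / 4"
  by (simp add: norm_add_sq norm_diff_sq)

lemma ip_tendsto: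
  assumes "(f \<longlongrightarrow> l) F" "(g \<longlongrightarrow> m) F"
  shows "((\<lambda>n. ip (f n) (g n)) \<longlongrightarrow> ip l m) F"
  unfolding ip_polarization by (intro tendsto_intros assms) simp

definition selfadj :: "'h :: chilbert_space endo \<Rightarrow> bool"
  where "selfadj T \<longleftrightarrow> (\<forall>x y. ip (ap T x) y = ip x (ap T y))"

lemma selfadjD: "selfadj T \<Longrightarrow> ip (ap T x) y = ip x (ap T y)"
  by (simp add: selfadj_def)

lemma selfadj_0 [simp]: "selfadj 0" and selfadj_1 [simp]: "selfadj 1"
  by (simp_all add: selfadj_def)

lemma selfadj_add: "selfadj S \<Longrightarrow> selfadj T \<Longrightarrow> selfadj (S + T)"
  and selfadj_diff: "selfadj S \<Longrightarrow> selfadj T \<Longrightarrow> selfadj (S - T)"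
  and selfadj_scaleR: "selfadj T \<Longrightarrow> selfadj (r *\<^sub>R T)"
  by (simp_all add: selfadj_def ip_simps)

lemma selfadj_mult: "selfadj S \<Longrightarrow> selfadj T \<Longrightarrow> S * T = T * S \<Longrightarrow> selfadj (S * T)"
  unfolding selfadj_def by (metis (no_types) ap_simps(6))

lemma norm_ap_sq: "selfadj T \<Longrightarrow> (norm (ap T v))\<^sup>2 = ip (ap (T * T) v) v"
  by (simp add: selfadjD flip: ip_self)

section \<open>Approximating the sign of a self-adjoint contraction\<close>

lemma commute_mult:
  fixes a b x :: "'a :: semigroup_mult"
  assumes "a * x = x * a" "b * x = x * b"
  shows "a * b * x = x * (a * b)"
proof -
  have "a * b * x = a * (x * b)" using assms(2) by (simp add: mult.assoc)
  also have "\<dots> = x * a * b" using assms(1) by (simp flip: mult.assoc)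
  finally show ?thesis by (simp add: mult.assoc)
qed

text \<open>Polynomials in \<open>1 - a\<^sup>2\<close> with nonnegative coefficients. They are positive operators when \<open>a\<close> is a
self-adjoint contraction, and unlike general positive operators they are closed under products for
an elementary reason.\<close>
inductive_set defect_cone :: "'h :: chilbert_space endo \<Rightarrow> 'h endo set"
  for a :: "'h endo"
  where
    one: "1 \<in> defect_cone a"
  | step: "T \<in> defect_cone a \<Longrightarrow> (1 - a * a) * T \<in> defect_cone a"
  | add: "S \<in> defect_cone a \<Longrightarrow> T \<in> defect_cone a \<Longrightarrow> S + T \<in> defect_cone a"
  | scale: "T \<in> defect_cone a \<Longrightarrow> 0 \<le> r \<Longrightarrow> r *\<^sub>R T \<in> defect_cone a"

lemma cone_mult: "S \<in> defect_cone a \<Longrightarrow> T \<in> defect_cone a \<Longrightarrow> S * T \<in> defect_cone a"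
  by (induction rule: defect_cone.induct) (auto simp: mult.assoc distrib_right intro: defect_cone.intros)

lemma cone_zero: "0 \<in> defect_cone a"
  using defect_cone.scale[OF defect_cone.one, of 0] by simp

lemma cone_commutes: "T \<in> defect_cone a \<Longrightarrow> a * x = x * a \<Longrightarrow> T * x = x * T"
proof (induction rule: defect_cone.induct)
  case (step T)
  have "(1 - a * a) * x = x * (1 - a * a)"
    using commute_mult[OF step.prems step.prems] by (simp add: left_diff_distrib right_diff_distrib)
  then show ?case using step.IH[OF step.prems] by (rule commute_mult)
qed (simp_all add: algebra_simps)

text \<open>For \<open>d = 1 - a\<^sup>2\<close> positivity of \<open>d\<^sup>2 T\<close> follows from that of \<open>T\<close>, by moving one factor \<open>d\<close> to the other
side of the inner product. The induction therefore carries \<open>T\<close> and \<open>d T\<close> along.\<close>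
lemma cone_nonneg:
  assumes T: "T \<in> defect_cone a" and a: "selfadj a" "\<And>v. norm (ap a v) \<le> norm v"
  shows "0 \<le> ip (ap T v) v"
proof -
  have d: "selfadj (1 - a * a)" using a by (intro selfadj_diff selfadj_mult) auto
  have d0: "0 \<le> ip (ap (1 - a * a) v) v" for v
    using power_mono[OF a(2)[of v], of 2] norm_ap_sq[OF a(1), of v] by (simp add: ip_simps ip_self)
  have "\<forall>v. 0 \<le> ip (ap T v) v \<and> 0 \<le> ip (ap ((1 - a * a) * T) v) v"
    using T
  proof induction
    case one
    then show ?case using d0 by (simp add: ip_self)
  next
    case (step T)
    have c: "(1 - a * a) * T = T * (1 - a * a)"
      using cone_commutes[OF step.hyps, of "1 - a * a"] by (simp add: algebra_simps)
    have "ip (ap ((1 - a * a) * ((1 - a * a) * T)) v) v = ip (ap T (ap (1 - a * a) v)) (ap (1 - a * a) v)" for v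
      using selfadjD[OF d] c by (metis ap_simps(6))
    then show ?case using step.IH by metis
  next
    case (add S T)
    then show ?case by (simp add: ip_simps distrib_left del: ap_simps(4,6)) 
  next
    case (scale T r)
    then show ?case by (simp add: ip_simps del: ap_simps(4,6))
  qed
  then show ?thesis by simp
qed

lemma cone_selfadj: "T \<in> defect_cone a \<Longrightarrow> selfadj a \<Longrightarrow> selfadj T"
proof (induction rule: defect_cone.induct)
  case (step T)
  then show ?case
    using cone_commutes[OF step.hyps, of "1 - a * a"]
    by (intro selfadj_mult selfadj_diff) (auto simp: algebra_simps)
qed (auto intro: selfadj_add selfadj_scaleR)

text \<open>One Newton--Schulz step \<open>s \<mapsto> s (3 - s\<^sup>2) / 2 = s + s (1 - s\<^sup>2) / 2\<close>, started at \<open>a\<close>, increases \<open>|s|\<close> towards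
\<open>1\<close> and keeps the sign. In terms of \<open>d = 1 - s\<^sup>2\<close> it is \<open>d \<mapsto> (3 d\<^sup>2 + d\<^sup>3) / 4\<close>, a polynomial with
nonnegative coefficients. The iterates are \<open>a h\<close> for factors \<open>h\<close> in the same cone.\<close>
fun sgn_defect :: "'h :: chilbert_space endo \<Rightarrow> nat \<Rightarrow> 'h endo" where
  "sgn_defect a 0 = 1 - a * a"
| "sgn_defect a (Suc n) = (3/4) *\<^sub>R (sgn_defect a n * sgn_defect a n)
    + (1/4) *\<^sub>R (sgn_defect a n * (sgn_defect a n * sgn_defect a n))"

fun sgn_factor :: "'h :: chilbert_space endo \<Rightarrow> nat \<Rightarrow> 'h endo" where
  "sgn_factor a 0 = 1"
| "sgn_factor a (Suc n) = sgn_factor a n + (1/2) *\<^sub>R (sgn_factor a n * sgn_defect a n)"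

definition sgn_approx :: "'h :: chilbert_space endo \<Rightarrow> nat \<Rightarrow> 'h endo"
  where "sgn_approx a n = a * sgn_factor a n"

lemma sgn_defect_cone: "sgn_defect a n \<in> defect_cone a"
  using defect_cone.step[OF defect_cone.one, of a]
  by (induction n) (auto intro!: defect_cone.add defect_cone.scale cone_mult)

lemma sgn_factor_cone: "sgn_factor a n \<in> defect_cone a"
  by (induction n) (auto intro!: defect_cone.one defect_cone.add defect_cone.scale cone_mult sgn_defect_cone)

lemma sgn_factor_diff_cone: "n \<le> m \<Longrightarrow> sgn_factor a m - sgn_factor a n \<in> defect_cone a"
proof (induction m rule: dec_induct)
  case base
  then show ?case by (simp add: cone_zero)
next
  case (step m)
  have "sgn_factor a (Suc m) - sgn_factor a n
      = (sgn_factor a m - sgn_factor a n) + (1/2) *\<^sub>R (sgn_factor a m * sgn_defect a m)"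
    by simp
  also have "\<dots> \<in> defect_cone a"
    by (intro defect_cone.add defect_cone.scale cone_mult sgn_defect_cone sgn_factor_cone step.IH) simp
  finally show ?case .
qed

lemma sgn_approx_square: "sgn_approx a n * sgn_approx a n = 1 - sgn_defect a n"
proof (induction n)
  case 0
  then show ?case by (simp add: sgn_approx_def)
next
  case (Suc n)
  define s where "s = sgn_approx a n"
  define d where "d = sgn_defect a n"
  have "d * a = a * d" unfolding d_def by (rule cone_commutes[OF sgn_defect_cone]) simp
  moreover have "d * sgn_factor a n = sgn_factor a n * d"
    unfolding d_def by (rule cone_commutes[OF sgn_defect_cone])
      (simp add: cone_commutes[OF sgn_factor_cone])
  ultimately have ds: "d * s = s * d"
    unfolding s_def sgn_approx_def by (intro commute_mult[symmetric]) simp_all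
  have ss: "s * s = 1 - d" using Suc by (simp add: s_def d_def)
  have dsx: "d * (s * x) = s * (d * x)" for x by (simp add: ds flip: mult.assoc)
  have three: "x + x + x = 3 *\<^sub>R x" and four: "x + x + x + x = 4 *\<^sub>R x" for x :: "'a endo"
    using scaleR_add_left[of 2 1 x] scaleR_add_left[of 2 2 x] by (simp_all add: scaleR_2 add.assoc)
  have "(s + s + s * d) * (s + s + s * d) = s * s * (1 + 1 + 1 + 1 + (d + d + d + d) + d * d)"
    by (simp add: algebra_simps ds dsx)
  also have "\<dots> = 1 + 1 + 1 + 1 - (d * d + d * d + d * d + d * (d * d))"
    unfolding ss by (simp add: algebra_simps)
  also have "1 + 1 + 1 + 1 = 4 *\<^sub>R (1 :: 'a endo)"
    by (rule four)
  also have "d * d + d * d + d * d + d * (d * d) = 4 *\<^sub>R sgn_defect a (Suc n)"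
    by (simp add: three scaleR_add_right flip: d_def)
  finally have sq: "(s + s + s * d) * (s + s + s * d) = 4 *\<^sub>R 1 - 4 *\<^sub>R sgn_defect a (Suc n)" .
  have "sgn_approx a (Suc n) = (1/2) *\<^sub>R (s + s + s * d)"
    by (simp add: sgn_approx_def s_def d_def distrib_left mult.assoc scaleR_add_right[of _ "_ + _"])
  then have "sgn_approx a (Suc n) * sgn_approx a (Suc n)
      = (1/4) *\<^sub>R ((s + s + s * d) * (s + s + s * d))" by simp
  then show ?case unfolding sq by (simp add: scaleR_diff_right del: sgn_defect.simps)
qed

lemma sgn_approx_commutes: "a * x = x * a \<Longrightarrow> sgn_approx a n * x = x * sgn_approx a n"
  unfolding sgn_approx_def by (intro commute_mult cone_commutes[OF sgn_factor_cone])

lemma sgn_approx_selfadj: "selfadj a \<Longrightarrow> selfadj (sgn_approx a n)"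
  unfolding sgn_approx_def
  using cone_commutes[OF sgn_factor_cone, of a a n]
  by (intro selfadj_mult cone_selfadj[OF sgn_factor_cone]) auto

lemma sgn_approx_Suc:
  "sgn_approx a (Suc n) = sgn_approx a n + (1/2) *\<^sub>R (sgn_approx a n - sgn_approx a n * (sgn_approx a n * sgn_approx a n))"
  unfolding sgn_approx_square by (simp add: sgn_approx_def algebra_simps)

lemma sgn_approx_contraction:
  assumes "selfadj a" "\<And>v. norm (ap a v) \<le> norm v"
  shows "norm (ap (sgn_approx a n) v) \<le> norm v"
proof -
  have "(norm (ap (sgn_approx a n) v))\<^sup>2 = (norm v)\<^sup>2 - ip (ap (sgn_defect a n) v) v"
    using norm_ap_sq[OF sgn_approx_selfadj[OF assms(1)]]
    unfolding sgn_approx_square by (simp add: ip_simps ip_self)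
  then show ?thesis
    using cone_nonneg[OF sgn_defect_cone assms, where v = v] by - (rule power2_le_imp_le, auto)
qed

text \<open>With \<open>s\<^sub>m = a h\<^sub>m\<close> the inner product of \<open>(s\<^sub>m - s\<^sub>n) v\<close> and \<open>s\<^sub>n v\<close> is that of \<open>h\<^sub>n (h\<^sub>m - h\<^sub>n) (a v)\<close> and
\<open>a v\<close>, which is nonnegative. So the norms \<open>|s\<^sub>n v|\<close> increase, and their convergence makes \<open>s\<^sub>n v\<close> a
Cauchy sequence.\<close>
lemma sgn_approx_increment:
  assumes "selfadj a" "\<And>v. norm (ap a v) \<le> norm v" "n \<le> m"
  shows "(norm (ap (sgn_approx a m) v - ap (sgn_approx a n) v))\<^sup>2
    \<le> (norm (ap (sgn_approx a m) v))\<^sup>2 - (norm (ap (sgn_approx a n) v))\<^sup>2"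
proof -
  let ?k = "sgn_factor a m - sgn_factor a n" and ?h = "sgn_factor a n"
  have 1: "ap (sgn_approx a m) v - ap (sgn_approx a n) v = ap ?k (ap a v)"
  proof -
    have "sgn_approx a m - sgn_approx a n = ?k * a"
      using cone_commutes[OF sgn_factor_diff_cone[OF assms(3)], of a]
      by (simp add: sgn_approx_def right_diff_distrib)
    then show ?thesis by (metis ap_simps(4) ap_simps(6))
  qed
  have 2: "ap (sgn_approx a n) v = ap ?h (ap a v)"
    unfolding sgn_approx_def using cone_commutes[OF sgn_factor_cone, of a a n] by (metis ap_simps(6))
  have "ip (ap ?k (ap a v)) (ap ?h (ap a v)) = ip (ap (?h * ?k) (ap a v)) (ap a v)"
    using selfadjD[OF cone_selfadj[OF sgn_factor_cone assms(1)]] by (metis ap_simps(6))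
  also have "\<dots> \<ge> 0"
    using assms by (intro cone_nonneg[where a = a] cone_mult sgn_factor_cone sgn_factor_diff_cone)
  finally have "ip (ap (sgn_approx a m) v - ap (sgn_approx a n) v) (ap (sgn_approx a n) v) \<ge> 0"
    unfolding 1 unfolding 2 .
  then show ?thesis
    unfolding norm_diff_sq by (simp only: ip_diff_left ip_self)
qed

section \<open>Projections in strongly closed operator algebras\<close>

text \<open>The properties of a von Neumann algebra that are used: sequential closedness in the strong topology,
adjoints with respect to the real inner product, and multiplication by the imaginary unit, which is
needed to write every element as a combination of self-adjoint ones.\<close>
locale strongly_closed_algebra = unital_subalgebra A
  for A :: "'h :: chilbert_space endo set" +
  assumes strong_limit: "(\<And>n. T n \<in> A) \<Longrightarrow> (\<And>v. (\<lambda>n. ap (T n) v) \<longlonglongrightarrow> ap L v) \<Longrightarrow> L \<in> A"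
    and adjoint_ex: "x \<in> A \<Longrightarrow> \<exists>y\<in>A. \<forall>v w. ip (ap x v) w = ip v (ap y w)"
    and imaginary_unit: "\<exists>j\<in>A. j * j = - 1 \<and> (\<forall>x\<in>A. j * x = x * j) \<and> (\<forall>v w. ip (ap j v) w = - ip v (ap j w))"
begin

lemma strong_limit_ex:
  assumes T: "\<And>n. T n \<in> A" "\<And>n v. norm (ap (T n) v) \<le> norm v"
    and C: "\<And>v. Cauchy (\<lambda>n. ap (T n) v)"
  obtains L where "L \<in> A" "\<And>v. (\<lambda>n. ap (T n) v) \<longlonglongrightarrow> ap L v"
proof -
  define f where "f v = lim (\<lambda>n. ap (T n) v)" for v
  have f: "(\<lambda>n. ap (T n) v) \<longlonglongrightarrow> f v" for v
    using C[of v] unfolding f_def Cauchy_convergent_iff by (simp add: convergent_LIMSEQ_iff)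
  have "bounded_linear f"
  proof (rule bounded_linear_intro[where K = 1])
    show "f (v + w) = f v + f w" for v w
      using tendsto_add[OF f[of v] f[of w]] f[of "v + w"] by (simp add: LIMSEQ_unique)
    show "f (r *\<^sub>R v) = r *\<^sub>R f v" for r v
      using tendsto_scaleR[OF tendsto_const f[of v], of r] f[of "r *\<^sub>R v"] by (simp add: LIMSEQ_unique)
    show "norm (f v) \<le> norm v * 1" for v
      using tendsto_norm[OF f[of v]] T(2) by (intro LIMSEQ_le_const2[of _ "norm (f v)"]) auto
  qed
  then have "ap (endo_of (Blinfun f)) v = f v" for v
    by (simp add: ap.rep_eq endo_of_inverse bounded_linear_Blinfun_apply)
  then have lim: "(\<lambda>n. ap (T n) v) \<longlonglongrightarrow> ap (endo_of (Blinfun f)) v" for v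
    using f by simp
  then show thesis
    using strong_limit[OF T(1) lim] that by blast
qed

lemma cone_mem: "T \<in> defect_cone a \<Longrightarrow> a \<in> A \<Longrightarrow> T \<in> A"
  by (induction rule: defect_cone.induct) auto

text \<open>The operator \<open>u\<close> is the sign of \<open>a\<close>: it is \<open>1\<close> on the positive part, \<open>-1\<close> on the negative part and \<open>0\<close> on
the kernel of \<open>a\<close>. The equation \<open>u\<^sup>3 = u\<close> is the fixed point equation of the iteration, and the
inequality quantifies that \<open>a u\<close> is the absolute value of the contraction \<open>a\<close> and thus at least \<open>a\<^sup>2\<close>.\<close>
lemma sign_operator:
  assumes a: "a \<in> A" "selfadj a" "\<And>v. norm (ap a v) \<le> norm v"
  obtains u where "u \<in> A" "selfadj u" "u * u * u = u" "u * u * a = a"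
    "\<And>x. a * x = x * a \<Longrightarrow> u * x = x * u"
    "\<And>v. (norm (ap a v))\<^sup>2 \<le> ip (ap (a * u) v) v"
    "\<And>v. ap a v = 0 \<Longrightarrow> ap u v = 0"
proof -
  let ?s = "sgn_approx a"
  note contr = sgn_approx_contraction[OF a(2,3)]
  have sA: "?s n \<in> A" for n
    using cone_mem[OF sgn_factor_cone a(1)] a(1) by (simp add: sgn_approx_def)
  have mono: "(norm (ap (?s n) v))\<^sup>2 \<le> (norm (ap (?s m) v))\<^sup>2" if "n \<le> m" for n m v
    using sgn_approx_increment[OF a(2,3) that, of v] zero_le_power2 by (smt (verit))
  have cauchy: "Cauchy (\<lambda>n. ap (?s n) v)" for v
  proof -
    have "convergent (\<lambda>n. (norm (ap (?s n) v))\<^sup>2)"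
    proof (rule Bseq_mono_convergent)
      show "Bseq (\<lambda>n. (norm (ap (?s n) v))\<^sup>2)"
        by (rule BseqI'[of _ "(norm v)\<^sup>2"]) (simp add: contr power_mono)
    qed (use mono in blast)
    then have C: "Cauchy (\<lambda>n. (norm (ap (?s n) v))\<^sup>2)" by (simp add: Cauchy_convergent_iff)
    show ?thesis
    proof (rule metric_CauchyI)
      fix e :: real assume "0 < e"
      then have "0 < e\<^sup>2" by simp
      then obtain N where N: "\<And>m n. m \<ge> N \<Longrightarrow> n \<ge> N \<Longrightarrow>
          dist ((norm (ap (?s m) v))\<^sup>2) ((norm (ap (?s n) v))\<^sup>2) < e\<^sup>2"
        using C unfolding Cauchy_def by blast
      have le: "dist (ap (?s m) v) (ap (?s n) v) < e" if "n \<le> m" "n \<ge> N" for m n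
      proof -
        have "(norm (ap (?s m) v - ap (?s n) v))\<^sup>2 < e\<^sup>2"
          using sgn_approx_increment[OF a(2,3) that(1), of v] N[of m n] that
          unfolding dist_real_def by (smt (verit) le_trans)
        then show ?thesis using \<open>0 < e\<close> by (simp add: dist_norm power_less_imp_less_base)
      qed
      show "\<exists>M. \<forall>m\<ge>M. \<forall>n\<ge>M. dist (ap (?s m) v) (ap (?s n) v) < e"
      proof (intro exI allI impI)
        fix m n assume "N \<le> m" "N \<le> n"
        then show "dist (ap (?s m) v) (ap (?s n) v) < e"
          using le[of n m] le[of m n] by (cases "n \<le> m") (simp_all add: dist_commute)
      qed
    qed
  qed
  obtain u where uA: "u \<in> A" and u: "\<And>v. (\<lambda>n. ap (?s n) v) \<longlonglongrightarrow> ap u v"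
    using strong_limit_ex[OF sA contr cauchy] by blast
  have lim_mult: "(\<lambda>n. ap (?s n) (f n)) \<longlonglongrightarrow> ap u l" if f: "f \<longlonglongrightarrow> l" for f l
  proof -
    have "(\<lambda>n. norm (f n - l)) \<longlonglongrightarrow> 0"
      using f by (simp add: LIM_zero tendsto_norm_zero)
    then have "(\<lambda>n. ap (?s n) (f n - l)) \<longlonglongrightarrow> 0"
      by (rule Lim_null_comparison[rotated]) (intro always_eventually allI contr)
    from tendsto_add[OF this u[of l]] show ?thesis by simp
  qed
  show thesis
  proof (rule that[OF uA])
    show "selfadj u"
      unfolding selfadj_def
    proof (intro allI)
      fix v w
      have "(\<lambda>n. ip (ap (?s n) v) w) \<longlonglongrightarrow> ip (ap u v) w"
        by (intro ip_tendsto u tendsto_const)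
      moreover have "(\<lambda>n. ip v (ap (?s n) w)) \<longlonglongrightarrow> ip v (ap u w)"
        by (intro ip_tendsto u tendsto_const)
      ultimately show "ip (ap u v) w = ip v (ap u w)"
        using selfadjD[OF sgn_approx_selfadj[OF a(2)]] by (simp add: LIMSEQ_unique)
    qed
    show uc: "u * x = x * u" if "a * x = x * a" for x
    proof (rule endo_eqI)
      fix v
      have "ap (?s n) (ap x v) = ap x (ap (?s n) v)" for n
        using sgn_approx_commutes[OF that, of n] by (metis ap_simps(6))
      then have "(\<lambda>n. ap (?s n) (ap x v)) \<longlonglongrightarrow> ap x (ap u v)"
        using ap_tendsto[OF u[of v], of x] by simp
      with u[of "ap x v"] show "ap (u * x) v = ap (x * u) v"
        by (simp add: LIMSEQ_unique)
    qed
    show uuu: "u * u * u = u"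
    proof (rule endo_eqI)
      fix v
      have L1: "(\<lambda>n. ap (?s n) v + (1/2) *\<^sub>R (ap (?s n) v - ap (?s n) (ap (?s n) (ap (?s n) v))))
          \<longlonglongrightarrow> ap u v + (1/2) *\<^sub>R (ap u v - ap u (ap u (ap u v)))"
        by (intro tendsto_intros u lim_mult)
      have L2: "(\<lambda>n. ap (?s n) v + (1/2) *\<^sub>R (ap (?s n) v - ap (?s n) (ap (?s n) (ap (?s n) v))))
          \<longlonglongrightarrow> ap u v"
        using LIMSEQ_Suc[OF u[of v]] unfolding sgn_approx_Suc by simp
      have "ap u v + (1/2) *\<^sub>R (ap u v - ap u (ap u (ap u v))) = ap u v"
        by (rule LIMSEQ_unique[OF L1 L2])
      then show "ap (u * u * u) v = ap u v" by simp
    qed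
    show "ap u v = 0" if "ap a v = 0" for v
    proof -
      have "ap (?s n) v = ap (sgn_factor a n) (ap a v)" for n
        unfolding sgn_approx_def using cone_commutes[OF sgn_factor_cone, of a a n] by (metis ap_simps(6))
      then have "(\<lambda>n. 0) \<longlonglongrightarrow> ap u v" using u[of v] that by simp
      then show ?thesis using LIMSEQ_unique tendsto_const by blast
    qed
    show "(norm (ap a v))\<^sup>2 \<le> ip (ap (a * u) v) v" for v
    proof (rule LIMSEQ_le_const)
      show "(\<lambda>n. ip (ap a (ap (?s n) v)) v) \<longlonglongrightarrow> ip (ap (a * u) v) v"
        unfolding ap_simps by (intro ip_tendsto ap_tendsto u tendsto_const)
      have "(norm (ap a v))\<^sup>2 \<le> ip (ap a (ap (?s n) v)) v" for n
      proof -
        have "ip (ap a (ap (?s n) v)) v = ip (ap (sgn_factor a n) (ap a v)) (ap a v)"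
          unfolding sgn_approx_def selfadjD[OF a(2)]
          using cone_commutes[OF sgn_factor_cone, of a a n] by (metis ap_simps(6))
        moreover have "0 \<le> ip (ap (sgn_factor a n - sgn_factor a 0) (ap a v)) (ap a v)"
          using a by (intro cone_nonneg[OF sgn_factor_diff_cone]) auto
        ultimately show ?thesis by (simp add: ip_diff_left ip_self)
      qed
      then show "\<exists>N. \<forall>n\<ge>N. (norm (ap a v))\<^sup>2 \<le> ip (ap a (ap (?s n) v)) v" by blast
    qed
    have ker: "ap a v = 0" if "ap u v = 0" for v
    proof -
      have "(norm (ap a v))\<^sup>2 \<le> (norm (ap u v))\<^sup>2"
      proof (rule LIMSEQ_le_const)
        show "(\<lambda>n. (norm (ap (?s n) v))\<^sup>2) \<longlonglongrightarrow> (norm (ap u v))\<^sup>2"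
          by (intro tendsto_intros u)
        show "\<exists>N. \<forall>n\<ge>N. (norm (ap a v))\<^sup>2 \<le> (norm (ap (?s n) v))\<^sup>2"
          using mono[of 0 _ v] by (auto simp: sgn_approx_def)
      qed
      then show ?thesis using that by simp
    qed
    have ua: "u * a = a * u" by (rule uc[OF refl])
    show "u * u * a = a"
    proof (rule endo_eqI)
      fix v
      have "ap u (v - ap u (ap u v)) = 0"
        using uuu by simp (metis ap_simps(6))
      then have "ap a (v - ap u (ap u v)) = 0" by (rule ker)
      moreover have "ap a (ap u (ap u v)) = ap (u * u * a) v"
        using commute_mult[OF ua ua] by (metis ap_simps(6))
      ultimately show "ap (u * u * a) v = ap a v" by simp
    qed
  qed
qed

definition projection :: "'h endo \<Rightarrow> bool"
  where "projection p \<longleftrightarrow> p \<in> A \<and> p * p = p \<and> selfadj p"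

lemma projection_compl: "projection p \<Longrightarrow> projection (1 - p)"
  by (auto simp: projection_def algebra_simps intro: selfadj_diff)

lemma projection_norm_split:
  assumes "projection p"
  shows "(norm v)\<^sup>2 = (norm (ap p v))\<^sup>2 + (norm (ap (1 - p) v))\<^sup>2"
proof -
  have "ip (ap p v) (ap (1 - p) v) = 0"
    using assms selfadjD[of p v "v - ap p v"] unfolding projection_def
    by simp (metis ap_simps(6) diff_self ip_zero(2))
  then show ?thesis using norm_add_sq[of "ap p v" "ap (1 - p) v"] by simp
qed

lemma projection_contraction: "projection p \<Longrightarrow> norm (ap p v) \<le> norm v"
  using projection_norm_split[of p v] by - (rule power2_le_imp_le, auto)

text \<open>The kernel of \<open>x\<close> is the kernel of the positive contraction \<open>a = x\<^sup>* x / K\<close>, and \<open>1 - u\<^sup>2\<close> projects onto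
it for the sign \<open>u\<close> of \<open>a\<close>.\<close>
lemma kernel_projection:
  assumes x: "x \<in> A"
  obtains q where "projection q" "x * q = 0" "\<And>v. ap x v = 0 \<Longrightarrow> ap q v = v"
proof -
  obtain y where y: "y \<in> A" "\<And>v w. ip (ap x v) w = ip v (ap y w)"
    using adjoint_ex[OF x] by blast
  have y': "ip (ap y v) w = ip v (ap x w)" for v w using y(2) by (metis ip_commute)
  define K where "K = norm (op_of (y * x)) + 1"
  have K: "K > 0" unfolding K_def by (simp add: add_nonneg_pos)
  define a where "a = (1/K) *\<^sub>R (y * x)"
  have aA: "a \<in> A" using x y by (simp add: a_def)
  have sa: "selfadj a"
    using y(2) y' by (auto simp: a_def selfadj_def ip_simps)
  have ca: "norm (ap a v) \<le> norm v" for v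
  proof -
    have "norm (ap (y * x) v) \<le> K * norm v"
      using ap_bound[of "y * x" v] by (simp add: K_def distrib_right add_increasing2)
    then show ?thesis using K by (simp add: a_def field_simps)
  qed
  have ax: "ap a v = 0 \<longleftrightarrow> ap x v = 0" for v
  proof
    assume "ap a v = 0"
    then have "ap y (ap x v) = 0" using K by (simp add: a_def)
    then have "ip (ap x v) (ap x v) = 0" using y(2)[of v "ap x v"] by simp
    then show "ap x v = 0" by (simp add: ip_self)
  qed (simp add: a_def)
  obtain u where u: "u \<in> A" "selfadj u" "u * u * u = u" "u * u * a = a"
    "\<And>x. a * x = x * a \<Longrightarrow> u * x = x * u" "\<And>v. ap a v = 0 \<Longrightarrow> ap u v = 0"
    using sign_operator[OF aA sa ca] by metis
  show thesis
  proof
    have uuuu: "u * (u * (u * u)) = u * u" using u(3) by (simp add: mult.assoc)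
    show "projection (1 - u * u)"
      unfolding projection_def
    proof (intro conjI)
      show "1 - u * u \<in> A" using u(1) by blast
      show "(1 - u * u) * (1 - u * u) = 1 - u * u" by (simp add: algebra_simps uuuu)
      show "selfadj (1 - u * u)" by (intro selfadj_diff selfadj_1 selfadj_mult u refl)
    qed
    have ua: "u * a = a * u" by (rule u(5)[OF refl])
    have "a * (1 - u * u) = 0"
      using commute_mult[OF ua ua] u(4) by (simp add: right_diff_distrib)
    then have "ap a (ap (1 - u * u) v) = 0" for v
      by (metis ap_simps(1) ap_simps(6))
    then have "ap (x * (1 - u * u)) v = ap 0 v" for v
      using ax[of "ap (1 - u * u) v"] by (simp only: ap_simps(1) ap_simps(6) simp_thms)
    then show "x * (1 - u * u) = 0" by (rule endo_eqI)
    show "ap (1 - u * u) v = v" if "ap x v = 0" for v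
      using that ax u(6) by simp
  qed
qed

text \<open>The projection is \<open>p = (u\<^sup>2 + u) / 2\<close> for the sign \<open>u\<close> of \<open>a\<close>, which is the value \<open>1\<close> part of \<open>u\<close>. The
inequalities say that \<open>0 \<le> a \<le> 1\<close> on its range, and \<open>-1 \<le> a \<le> 0\<close> on the complement.\<close>
lemma spectral_projection:
  assumes a: "a \<in> A" "selfadj a" "\<And>v. norm (ap a v) \<le> norm v"
  obtains p where "projection p" "\<And>x. a * x = x * a \<Longrightarrow> p * x = x * p"
    "\<And>v. (norm (ap a (ap p v)))\<^sup>2 \<le> ip (ap a (ap p v)) (ap p v)"
    "\<And>v. (norm (ap a (ap (1 - p) v)))\<^sup>2 \<le> - ip (ap a (ap (1 - p) v)) (ap (1 - p) v)"
proof -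
  obtain u where u: "u \<in> A" "selfadj u" "u * u * u = u" "u * u * a = a"
    and uc: "\<And>x. a * x = x * a \<Longrightarrow> u * x = x * u"
    and pos: "\<And>v. (norm (ap a v))\<^sup>2 \<le> ip (ap (a * u) v) v"
    using sign_operator[OF a] by metis
  define p where "p = (1/2) *\<^sub>R (u * u + u)"
  have uuu: "u * (u * u) = u" and uuuu: "u * (u * (u * u)) = u * u" using u(3) by (simp_all add: mult.assoc)
  have up: "u * p = p" by (simp add: p_def distrib_left uuu add.commute)
  have pp: "p * p = p"
  proof -
    have "p * p = (1/2) *\<^sub>R (u * (u * p) + u * p)" by (subst p_def) (simp add: algebra_simps)
    also have "\<dots> = (1/2) *\<^sub>R (p + p)" unfolding up ..
    finally show ?thesis by simp
  qed
  have ua: "u * a = a * u" by (rule uc[OF refl])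
  have auu: "a * (u * u) = a" using commute_mult[OF ua ua] u(4) by simp
  \<comment> \<open>On the range of \<open>1 - p\<close> the sign is \<open>-1\<close> or \<open>0\<close>, and \<open>a\<close> vanishes where it is \<open>0\<close>.\<close>
  have au1: "a * (u * (1 - p)) = - (a * (1 - p))"
  proof -
    have "a * (u * (1 - p)) + a * (1 - p) = a * (1 + u - (p + p))"
      by (simp add: right_diff_distrib distrib_left up)
    also have "p + p = u * u + u" by (simp add: p_def flip: scaleR_2)
    finally have "a * (u * (1 - p)) + a * (1 - p) = 0"
      by (simp add: right_diff_distrib distrib_left auu)
    then show ?thesis by (rule eq_neg_iff_add_eq_0[THEN iffD2])
  qed
  show thesis
  proof
    show "projection p" unfolding projection_def
    proof (intro conjI pp)
      show "p \<in> A" using u by (simp add: p_def)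
      show "selfadj p" unfolding p_def by (intro selfadj_scaleR selfadj_add selfadj_mult u refl)
    qed
    show "p * x = x * p" if "a * x = x * a" for x
      unfolding p_def using uc[OF that] commute_mult[OF uc[OF that] uc[OF that]]
      by (simp add: distrib_left distrib_right)
    show "(norm (ap a (ap p v)))\<^sup>2 \<le> ip (ap a (ap p v)) (ap p v)" for v
      using pos[of "ap p v"] up by (metis ap_simps(6))
    show "(norm (ap a (ap (1 - p) v)))\<^sup>2 \<le> - ip (ap a (ap (1 - p) v)) (ap (1 - p) v)" for v
    proof -
      have "ap (a * u) (ap (1 - p) v) = - ap a (ap (1 - p) v)"
        using au1 by (metis ap_simps(5,6))
      then show ?thesis using pos[of "ap (1 - p) v"] by (simp only: ip_minus_left)
    qed
  qed
qed

end

section \<open>Operators commuting with all projections\<close>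

context strongly_closed_algebra
begin

text \<open>If \<open>t\<close> is within \<open>w\<close> of the scalar \<open>l\<close> on the range of \<open>c\<close>, the commutator of \<open>s\<close> and \<open>t\<close> is at most
\<open>2 |s| w\<close> there. Splitting \<open>c\<close> by the spectral projection of \<open>(t - l) / w\<close> halves \<open>w\<close> on both parts, with
the centres \<open>l + w/2\<close> and \<open>l - w/2\<close>; since the commutator respects the orthogonal decomposition, the
bound for \<open>c\<close> is the bound for the parts.\<close>
lemma commutator_bisection:
  assumes s: "\<And>p. projection p \<Longrightarrow> s * p = p * s"
    and t: "t \<in> A" "selfadj t"
    and c: "projection c" "c * t = t * c" and w: "0 < w"
    and bound: "\<And>v. norm (ap (t - l *\<^sub>R 1) (ap c v)) \<le> w * norm (ap c v)"
  shows "norm (ap (s * t - t * s) (ap c v)) \<le> 2 * norm (op_of s) * w / 2 ^ k * norm (ap c v)"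
  using c w bound
proof (induction k arbitrary: c l w v)
  case (0 c l w v)
  let ?y = "ap c v" and ?T = "t - l *\<^sub>R 1" and ?S = "norm (op_of s)"
  have sy: "ap s ?y = ap c (ap s v)" using s[OF 0(1)] by (metis ap_simps(6))
  have "ap (s * t - t * s) ?y = ap s (ap ?T ?y) - ap ?T (ap s ?y)" by simp
  then have "norm (ap (s * t - t * s) ?y) \<le> norm (ap s (ap ?T ?y)) + norm (ap ?T (ap s ?y))"
    by (metis norm_triangle_ineq4)
  also have "norm (ap s (ap ?T ?y)) \<le> ?S * (w * norm ?y)"
    using ap_bound[of s "ap ?T ?y"] 0(4)[of v] by (meson mult_left_mono norm_ge_zero order_trans)
  also have "norm (ap ?T (ap s ?y)) \<le> w * norm (ap s ?y)"
    unfolding sy by (rule 0(4))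
  also have "w * norm (ap s ?y) \<le> w * (?S * norm ?y)"
    using ap_bound[of s ?y] 0(3) by (simp add: mult_left_mono)
  finally show ?case by (simp add: algebra_simps)
next
  case (Suc k c l w v)
  define a where "a = (1/w) *\<^sub>R ((t - l *\<^sub>R 1) * c)"
  have cA: "c \<in> A" and cc: "c * c = c" and sc: "selfadj c" using Suc.prems(1) by (auto simp: projection_def)
  have ac: "a * c = a" by (simp add: a_def mult.assoc cc)
  have ca: "c * a = a"
    using Suc.prems(2) cc unfolding a_def
    by (simp add: left_diff_distrib right_diff_distrib flip: mult.assoc) (simp add: mult.assoc cc)
  have at: "a * t = t * a"
    using Suc.prems(2) unfolding a_def
    by (simp add: left_diff_distrib right_diff_distrib mult.assoc)
  have aA: "a \<in> A" using t cA by (auto simp: a_def)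
  have sa: "selfadj a"
    unfolding a_def using Suc.prems(2) t sc
    by (intro selfadj_scaleR selfadj_mult selfadj_diff) (auto simp: algebra_simps selfadj_scaleR)
  have wa: "w *\<^sub>R ap a v = ap (t - l *\<^sub>R 1) (ap c v)" for v
    using Suc.prems(3) by (simp add: a_def)
  have na: "norm (ap a v) \<le> norm v" for v
  proof -
    have "w * norm (ap a v) = norm (w *\<^sub>R ap a v)" using Suc.prems(3) by simp
    also have "\<dots> \<le> w * norm (ap c v)" unfolding wa by (rule Suc.prems(4))
    also have "\<dots> \<le> w * norm v"
      using projection_contraction[OF Suc.prems(1)] Suc.prems(3) by simp
    finally show ?thesis using Suc.prems(3) by simp
  qed
  obtain p where p: "projection p" and pc: "\<And>x. a * x = x * a \<Longrightarrow> p * x = x * p"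
    and pos: "\<And>v. (norm (ap a (ap p v)))\<^sup>2 \<le> ip (ap a (ap p v)) (ap p v)"
    and neg: "\<And>v. (norm (ap a (ap (1 - p) v)))\<^sup>2 \<le> - ip (ap a (ap (1 - p) v)) (ap (1 - p) v)"
    using spectral_projection[OF aA sa na] by metis
  have p_c: "p * c = c * p" by (rule pc) (simp add: ac ca)
  have p_t: "p * t = t * p" by (rule pc) (rule at)
  let ?K = "2 * norm (op_of s) * (w/2) / 2 ^ k"
  have K: "?K = 2 * norm (op_of s) * w / 2 ^ Suc k" by simp
  \<comment> \<open>The sign \<open>r\<close> treats the two halves \<open>q = p\<close> and \<open>q = 1 - p\<close> together.\<close>
  have step: "norm (ap (s * t - t * s) (ap q (ap c v))) \<le> ?K * norm (ap q (ap c v))"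
    if q: "projection q" "q * c = c * q" "q * t = t * q"
      and e: "\<And>v. (norm (ap a (ap q v)))\<^sup>2 \<le> r * ip (ap a (ap q v)) (ap q v)"
      and r: "r * r = 1" for q r v
  proof -
    have qc: "ap q (ap c v) = ap (c * q) v" for v using q(2) by (metis ap_simps(6))
    have "norm (ap (s * t - t * s) (ap (c * q) v)) \<le> ?K * norm (ap (c * q) v)"
    proof (rule Suc.IH)
      have "c * q * (c * q) = c * q"
        using q(1,2) cc unfolding projection_def by (metis mult.assoc)
      then show "projection (c * q)"
        using q cA sc unfolding projection_def by (auto intro: selfadj_mult)
      show "c * q * t = t * (c * q)" by (rule commute_mult[OF Suc.prems(2) q(3)])
      show "0 < w/2" using Suc.prems(3) by simp
      fix v
      let ?y = "ap (c * q) v"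
      have yq: "?y = ap q (ap c v)" by (simp only: qc)
      have cy: "ap c ?y = ?y" using cc by (metis ap_simps(6))
      have "ap (t - (l + r * (w/2)) *\<^sub>R 1) ?y = ap (t - l *\<^sub>R 1) (ap c ?y) - (r * (w/2)) *\<^sub>R ?y"
        unfolding cy by (simp add: scaleR_add_left)
      also have "\<dots> = w *\<^sub>R (ap a ?y - (r/2) *\<^sub>R ?y)"
        unfolding wa[symmetric] by (simp add: scaleR_diff_right mult.commute)
      finally have "norm (ap (t - (l + r * (w/2)) *\<^sub>R 1) ?y) = w * norm (ap a ?y - (r/2) *\<^sub>R ?y)"
        using Suc.prems(3) by simp
      moreover have "norm (ap a ?y - (r/2) *\<^sub>R ?y) \<le> norm ?y / 2"
      proof (rule power2_le_imp_le)
        have "(norm (ap a ?y - (r/2) *\<^sub>R ?y))\<^sup>2 = (norm (ap a ?y))\<^sup>2 - r * ip (ap a ?y) ?y + (r * r) * (norm ?y)\<^sup>2 / 4"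
          by (rule norm_diff_half_scaled)
        also have "\<dots> \<le> (norm ?y / 2)\<^sup>2"
          using e[of "ap c v"] unfolding r yq by (simp add: power_divide)
        finally show "(norm (ap a ?y - (r/2) *\<^sub>R ?y))\<^sup>2 \<le> (norm ?y / 2)\<^sup>2" .
      qed simp
      ultimately show "norm (ap (t - (l + r * (w/2)) *\<^sub>R 1) ?y) \<le> w/2 * norm ?y"
        using Suc.prems(3) by simp
    qed
    then show ?thesis unfolding qc .
  qed
  define C where "C = s * t - t * s"
  have Cp: "C * p = p * C"
    unfolding C_def left_diff_distrib right_diff_distrib
    using commute_mult[OF s[OF p] p_t[symmetric]] commute_mult[OF p_t[symmetric] s[OF p]] by simp
  have split: "(norm (ap C y))\<^sup>2 = (norm (ap C (ap p y)))\<^sup>2 + (norm (ap C (ap (1 - p) y)))\<^sup>2" for y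
  proof -
    have "ap p (ap C y) = ap C (ap p y)" using Cp by (metis ap_simps(6))
    then show ?thesis using projection_norm_split[OF p, of "ap C y"] by simp
  qed
  let ?y = "ap c v"
  have "(norm (ap C ?y))\<^sup>2 \<le> (?K * norm (ap p ?y))\<^sup>2 + (?K * norm (ap (1 - p) ?y))\<^sup>2"
    unfolding split[of ?y]
  proof (intro add_mono power_mono)
    show "norm (ap C (ap p ?y)) \<le> ?K * norm (ap p ?y)"
      unfolding C_def using pos by (intro step[where r = 1] p p_c p_t) auto
    show "norm (ap C (ap (1 - p) ?y)) \<le> ?K * norm (ap (1 - p) ?y)"
      unfolding C_def using neg p_c p_t
      by (intro step[where r = "-1"] projection_compl p) (simp_all add: left_diff_distrib right_diff_distrib del: ap_simps(4))
  qed simp_all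
  also have "\<dots> = (?K * norm ?y)\<^sup>2"
    unfolding power_mult_distrib projection_norm_split[OF p, of ?y] by (simp only: distrib_left)
  finally have "norm (ap C ?y) \<le> ?K * norm ?y"
    by (rule power2_le_imp_le) (use Suc.prems(3) in simp)
  then show ?case unfolding K C_def .
qed

lemma commutes_selfadj:
  assumes s: "\<And>p. projection p \<Longrightarrow> s * p = p * s"
    and t: "t \<in> A" "selfadj t"
  shows "s * t = t * s"
proof -
  let ?w = "norm (op_of t) + 1"
  have w: "0 < ?w" by (simp add: add_nonneg_pos)
  have one: "projection 1" by (simp add: projection_def)
  have "ap (s * t - t * s) v = 0" for v
  proof -
    let ?K = "2 * norm (op_of s) * ?w * norm v"
    have "norm (ap (t - 0 *\<^sub>R 1) (ap 1 u)) \<le> ?w * norm (ap 1 u)" for u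
      using ap_bound[of t u] by (simp add: distrib_right add_increasing2)
    from commutator_bisection[OF s t one _ w this, of v]
    have "norm (ap (s * t - t * s) v) \<le> ?K * (1/2) ^ k" for k
      by (simp add: power_divide)
    moreover have "(\<lambda>k. ?K * (1/2) ^ k) \<longlonglongrightarrow> ?K * 0"
      by (intro tendsto_intros LIMSEQ_power_zero) simp
    ultimately have "norm (ap (s * t - t * s) v) \<le> ?K * 0"
      by (intro LIMSEQ_le_const[where X = "\<lambda>k. ?K * (1/2) ^ k"]) blast+
    then show ?thesis by simp
  qed
  then have "s * t - t * s = 0" by (intro endo_eqI) simp
  then show ?thesis by simp
qed

text \<open>An element \<open>x\<close> with adjoint \<open>y\<close> is half the sum of the self-adjoint \<open>x + y\<close> and the skew \<open>x - y\<close>, and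
\<open>j (x - y)\<close> is self-adjoint for the imaginary unit \<open>j\<close>.\<close>
lemma commutes_projections_central:
  assumes s: "s \<in> A" "\<And>p. projection p \<Longrightarrow> s * p = p * s" and x: "x \<in> A"
  shows "s * x = x * s"
proof -
  obtain y where y: "y \<in> A" and xy: "\<And>v w. ip (ap x v) w = ip v (ap y w)"
    using adjoint_ex[OF x] by blast
  have yx: "ip (ap y v) w = ip v (ap x w)" for v w using xy by (metis ip_commute)
  obtain j where j: "j \<in> A" "j * j = - 1" and jc: "\<And>x. x \<in> A \<Longrightarrow> j * x = x * j"
    and js: "\<And>v w. ip (ap j v) w = - ip v (ap j w)"
    using imaginary_unit by blast
  have "selfadj (x + y)" by (simp add: selfadj_def ip_simps xy yx)
  then have 1: "s * (x + y) = (x + y) * s" using x y by (intro commutes_selfadj[OF s(2)]) auto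
  have jd: "ap j (ap (x - y) v) = ap (x - y) (ap j v)" for v
    using jc[of "x - y"] x y by (metis ap_simps(6) diff_mem)
  have "selfadj (j * (x - y))"
    unfolding selfadj_def
  proof (intro allI)
    fix v w
    have "ip (ap (j * (x - y)) v) w = ip v (ap (x - y) (ap j w))"
      by (simp add: js ip_simps xy yx)
    then show "ip (ap (j * (x - y)) v) w = ip v (ap (j * (x - y)) w)"
      using jd by simp
  qed
  then have "s * (j * (x - y)) = j * (x - y) * s" using j x y by (intro commutes_selfadj[OF s(2)]) auto
  then have "j * (s * (x - y)) = j * ((x - y) * s)"
    using jc[OF s(1)] by (metis mult.assoc)
  then have "j * (j * (s * (x - y))) = j * (j * ((x - y) * s))" by simp
  moreover have "j * (j * b) = - b" for b using j(2) by (simp flip: mult.assoc)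
  ultimately have 2: "s * (x - y) = (x - y) * s" by (simp only: neg_equal_iff_equal)
  have "x + x = (x + y) + (x - y)" by simp
  then have "s * (x + x) = (x + x) * s" using 1 2 by (metis distrib_left distrib_right)
  then have "s * x + s * x = x * s + x * s" by (simp only: distrib_left distrib_right)
  then show ?thesis by (rule double_cancel)
qed

text \<open>Take \<open>y\<close> to be the adjoint of \<open>x\<close>: if \<open>x y x = 0\<close>, then \<open>|y x v|\<^sup>2\<close> and \<open>|x v|\<^sup>2\<close> vanish in turn.\<close>
lemma semiprime_star:
  assumes x: "x \<in> A" and "\<And>y. y \<in> A \<Longrightarrow> x * y * x = 0"
  shows "x = 0"
proof (rule endo_eqI)
  fix v
  obtain y where y: "y \<in> A" and xy: "\<And>v w. ip (ap x v) w = ip v (ap y w)"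
    using adjoint_ex[OF x] by blast
  have xyx: "ap x (ap y (ap x v)) = 0" using assms(2)[OF y] by (metis ap_simps(1,6))
  have "ip (ap x (ap y (ap x v))) (ap x v) = 0" unfolding xyx by simp
  then have "ap y (ap x v) = 0" unfolding xy by (simp add: ip_self)
  then have "ip (ap x v) (ap x v) = 0" unfolding xy by simp
  then show "ap x v = ap 0 v" by (simp add: ip_self)
qed

end

section \<open>Idempotents in the absence of abelian summands\<close>

locale no_abelian_summand = strongly_closed_algebra +
  assumes no_abelian: "projection z \<Longrightarrow> (\<And>x. x \<in> A \<Longrightarrow> z * x = x * z) \<Longrightarrow>
    (\<And>x y. x \<in> A \<Longrightarrow> y \<in> A \<Longrightarrow> (z * x * z) * (z * y * z) = (z * y * z) * (z * x * z)) \<Longrightarrow> z = 0"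
begin

text \<open>The annihilating elements form a two-sided ideal. It contains the complement \<open>z\<close> of the kernel
projection of \<open>x\<close>, because \<open>x y = 0\<close> implies \<open>z y = 0\<close>. For \<open>b\<close> in \<open>z A\<close> and an idempotent \<open>e\<close> the
commutator \<open>[e, b]\<close> is in the ideal and at the same time a commutator with \<open>e\<close>, so
\<open>[e, b] A [e, b] = 0\<close>. Hence \<open>z A\<close> is central, and \<open>z\<close> is a central abelian projection.\<close>
lemma idempotents_faithful_star:
  assumes x: "x \<in> A"
    and ann: "\<And>e y z. e \<in> A \<Longrightarrow> e * e = e \<Longrightarrow> y \<in> A \<Longrightarrow> z \<in> A \<Longrightarrow> x * y * (e * z - z * e) = 0"
  shows "x = 0"
proof -
  obtain q where q: "projection q" "x * q = 0" "\<And>v. ap x v = 0 \<Longrightarrow> ap q v = v"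
    using kernel_projection[OF x] by metis
  define z where "z = 1 - q"
  have z: "projection z" unfolding z_def by (rule projection_compl[OF q(1)])
  then have zA: "z \<in> A" by (simp add: projection_def)
  have zann: "z * (y * (e * b - b * e)) = 0" if "e \<in> A" "e * e = e" "y \<in> A" "b \<in> A" for e y b
  proof (rule endo_eqI)
    fix v
    have "ap x (ap (y * (e * b - b * e)) v) = 0"
      using ann[OF that] by (metis ap_simps(1) ap_simps(6) mult.assoc)
    note qy = q(3)[OF this]
    have "ap (z * B) v = ap B v - ap q (ap B v)" for B by (simp add: z_def)
    then show "ap (z * (y * (e * b - b * e))) v = ap 0 v"
      by (simp only: qy diff_self ap_simps(1))
  qed
  have comm: "z * b * e = e * (z * b)" if b: "b \<in> A" and e: "e \<in> A" "e * e = e" for b e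
  proof -
    let ?c = "e * (z * b) - z * b * e"
    have "?c = 0"
    proof (rule semiprime_star)
      show "?c \<in> A" using b e zA by auto
      fix y assume y: "y \<in> A"
      have "?c * y * ?c = e * (z * (b * y * ?c)) - z * (b * e * y * ?c)"
        by (simp only: left_diff_distrib mult.assoc)
      also have "z * (b * y * ?c) = 0" using b e y zA by (intro zann) auto
      also have "z * (b * e * y * ?c) = 0" using b e y zA by (intro zann) auto
      finally show "?c * y * ?c = 0" by simp
    qed
    then show ?thesis by simp
  qed
  have central: "z * b * c = c * (z * b)" if "b \<in> A" "c \<in> A" for b c
  proof (rule commutes_projections_central)
    show "z * b \<in> A" using that(1) zA by auto
    show "z * b * p = p * (z * b)" if "projection p" for p
      using comm[OF \<open>b \<in> A\<close>, of p] that unfolding projection_def by blast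
  qed (rule that(2))
  have "z = 0"
  proof (rule no_abelian[OF z])
    show zc: "z * b = b * z" if "b \<in> A" for b using central[of 1 b] that by simp
    show "z * b * z * (z * c * z) = z * c * z * (z * b * z)" if "b \<in> A" "c \<in> A" for b c
      using central[of "b * z" "z * c * z"] that zA by (simp add: mult.assoc)
  qed
  then have "q = 1" by (simp add: z_def)
  with q(2) show ?thesis by simp
qed

lemma semiprime_with_idempotents: "semiprime_with_idempotents A"
  by unfold_locales (fact semiprime_star, fact idempotents_faithful_star)

end

section \<open>Von Neumann algebras\<close>

definition endos :: "('h :: chilbert_space \<Rightarrow>\<^sub>L 'h) set \<Rightarrow> 'h endo set"
  where "endos M = {T. op_of T \<in> M}"

lemma mem_endos [simp]: "T \<in> endos M \<longleftrightarrow> op_of T \<in> M"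
  by (simp add: endos_def)

lemmas op_of_simps = zero_endo.rep_eq one_endo.rep_eq plus_endo.rep_eq minus_endo.rep_eq
  uminus_endo.rep_eq times_endo.rep_eq scaleR_endo.rep_eq

lemma strong_closed_sequentially:
  fixes M :: "('a :: real_normed_vector \<Rightarrow>\<^sub>L 'b :: real_normed_vector) set"
  assumes M: "closedin strong_operator_topology M" and T: "\<And>n. T n \<in> M"
    and lim: "\<And>v. (\<lambda>n. blinfun_apply (T n) v) \<longlonglongrightarrow> blinfun_apply L v"
  shows "L \<in> M"
proof (rule ccontr)
  assume "L \<notin> M"
  have "openin strong_operator_topology (UNIV - M)"
    using M by (simp add: closedin_def strong_operator_topology_topspace)
  then obtain U where U: "open U" "UNIV - M = blinfun_apply -` U"
    unfolding strong_operator_topology_def openin_pullback_topology by auto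
  have "limitin (product_topology (\<lambda>_. euclidean) UNIV) (\<lambda>n. blinfun_apply (T n)) (blinfun_apply L) sequentially"
    using lim by (simp add: limitin_componentwise)
  then have "limitin euclidean (\<lambda>n. blinfun_apply (T n)) (blinfun_apply L) sequentially"
    by (simp only: euclidean_product_topology)
  then have "(\<lambda>n. blinfun_apply (T n)) \<longlonglongrightarrow> blinfun_apply L" by simp
  moreover have "blinfun_apply L \<in> U" using U(2) \<open>L \<notin> M\<close> by auto
  ultimately have "eventually (\<lambda>n. blinfun_apply (T n) \<in> U) sequentially"
    using U(1) by (simp add: tendsto_def)
  then obtain n where "blinfun_apply (T n) \<in> U" by (auto simp: eventually_sequentially)
  then show False using U(2) T[of n] by auto
qed

lemma scaleC_minus_one: "(-1) *\<^sub>C v = - (v :: 'h :: chilbert_space)"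
  using scaleR_scaleC[of "-1" v] by simp

lemma Im_cinner: "Im (cinner v w) = ip ((- \<i>) *\<^sub>C v) w"
  by (simp add: ip_def cinner_scaleC_left)

text \<open>The imaginary part of the inner product is the real part after multiplication by \<open>- \<i>\<close>, with which a
complex linear operator commutes.\<close>
lemma is_adjoint_selfadj:
  assumes "op_of p \<in> clinear_ops" "selfadj p"
  shows "is_adjoint (op_of p) (op_of p)"
  unfolding is_adjoint_def
proof (intro allI complex_eqI)
  fix v w
  have sa: "ip (blinfun_apply (op_of p) v) w = ip v (blinfun_apply (op_of p) w)" for v w
    using selfadjD[OF assms(2)] by (simp add: ap.rep_eq)
  show "Re (cinner (blinfun_apply (op_of p) v) w) = Re (cinner v (blinfun_apply (op_of p) w))"
    using sa[of v w] by (simp add: ip_def)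
  have "(- \<i>) *\<^sub>C blinfun_apply (op_of p) v = blinfun_apply (op_of p) ((- \<i>) *\<^sub>C v)"
    using assms(1) by (simp add: clinear_ops_def)
  then show "Im (cinner (blinfun_apply (op_of p) v) w) = Im (cinner v (blinfun_apply (op_of p) w))"
    unfolding Im_cinner by (simp add: sa)
qed

lemma von_neumann_no_abelian_summand:
  fixes M :: "('h :: chilbert_space \<Rightarrow>\<^sub>L 'h) set"
  assumes M: "von_neumann_algebra M" and I1: "no_central_summand_type_I1 M"
  shows "no_abelian_summand (endos M)"
proof -
  have cs: "cstar_subalgebra M" and idM: "id_blinfun \<in> M" and cl: "closedin strong_operator_topology M"
    using M by (auto simp: von_neumann_algebra_def)
  have clin: "M \<subseteq> clinear_ops" and addM: "\<And>S T. S \<in> M \<Longrightarrow> T \<in> M \<Longrightarrow> S + T \<in> M"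
    and scaleM: "\<And>a T. T \<in> M \<Longrightarrow> scaleC_op a T \<in> M"
    and multM: "\<And>S T. S \<in> M \<Longrightarrow> T \<in> M \<Longrightarrow> S o\<^sub>L T \<in> M"
    and adjM: "\<And>T. T \<in> M \<Longrightarrow> \<exists>S\<in>M. is_adjoint S T"
    using cs by (auto simp: cstar_subalgebra_def)
  have scaleR: "scaleC_op (complex_of_real r) T = r *\<^sub>R T" for r and T :: "'h \<Rightarrow>\<^sub>L 'h"
    by (rule blinfun_eqI) (simp add: scaleC_op.rep_eq scaleR_scaleC blinfun.scaleR_left)
  interpret strongly_closed_algebra "endos M"
  proof unfold_locales
    show "1 \<in> endos M" using idM by (simp add: op_of_simps)
    show "x + y \<in> endos M" if "x \<in> endos M" "y \<in> endos M" for x y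
      using that by (simp add: op_of_simps addM)
    show "x * y \<in> endos M" if "x \<in> endos M" "y \<in> endos M" for x y
      using that by (simp add: op_of_simps multM)
    show "r *\<^sub>R x \<in> endos M" if "x \<in> endos M" for r x
      using that scaleM[of "op_of x" "complex_of_real r"] by (simp add: op_of_simps scaleR)
    show "L \<in> endos M" if "\<And>n. T n \<in> endos M" "\<And>v. (\<lambda>n. ap (T n) v) \<longlonglongrightarrow> ap L v" for T L
      using strong_closed_sequentially[OF cl, of "\<lambda>n. op_of (T n)" "op_of L"] that
      by (simp add: ap.rep_eq)
    show "\<exists>y\<in>endos M. \<forall>v w. ip (ap x v) w = ip v (ap y w)" if x: "x \<in> endos M" for x
    proof -
      obtain S where S: "S \<in> M" "is_adjoint S (op_of x)" using adjM x by auto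
      have "ip (ap x v) w = ip v (ap (endo_of S) w)" for v w
      proof -
        have "cinner (blinfun_apply S w) v = cinner w (ap x v)"
          using S(2) by (simp add: is_adjoint_def ap.rep_eq)
        then have "ip (blinfun_apply S w) v = ip w (ap x v)" by (simp only: ip_def)
        then show ?thesis
          by (simp add: ip_commute[of v] ip_commute[of _ w] ap.rep_eq endo_of_inverse)
      qed
      then show ?thesis using S(1) by (intro bexI[of _ "endo_of S"]) (auto simp: endo_of_inverse)
    qed
    show "\<exists>j\<in>endos M. j * j = - 1 \<and> (\<forall>x\<in>endos M. j * x = x * j) \<and>
      (\<forall>v w. ip (ap j v) w = - ip v (ap j w))"
    proof (intro bexI conjI ballI allI)
      let ?j = "endo_of (scaleC_op \<i> id_blinfun) :: 'h endo"
      have apj: "ap ?j v = \<i> *\<^sub>C v" for v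
        by (simp add: ap.rep_eq endo_of_inverse scaleC_op.rep_eq)
      show "?j \<in> endos M" using scaleM[OF idM] by (simp add: endo_of_inverse)
      show "?j * ?j = - 1"
        by (rule endo_eqI) (simp add: apj scaleC_scaleC scaleC_minus_one)
      show "?j * x = x * ?j" if "x \<in> endos M" for x
      proof (rule endo_eqI)
        fix v
        have "op_of x \<in> clinear_ops" using that clin by auto
        then show "ap (?j * x) v = ap (x * ?j) v"
          unfolding ap_simps apj by (simp add: clinear_ops_def ap.rep_eq)
      qed
      show "ip (ap ?j v) w = - ip v (ap ?j w)" for v w
      proof -
        have "ip v (\<i> *\<^sub>C w) = Re (cinner (\<i> *\<^sub>C w) v)" unfolding ip_def[symmetric] by (rule ip_commute)
        also have "\<dots> = - Im (cinner w v)" by (simp add: cinner_scaleC_left)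
        also have "Im (cinner w v) = - Im (cinner v w)" by (subst cinner_commute) simp
        finally show ?thesis unfolding apj by (simp add: ip_def cinner_scaleC_left)
      qed
    qed
  qed
  show ?thesis
  proof unfold_locales
    fix z assume z: "projection z" and zc: "\<And>x. x \<in> endos M \<Longrightarrow> z * x = x * z"
      and ab: "\<And>x y. x \<in> endos M \<Longrightarrow> y \<in> endos M \<Longrightarrow> z * x * z * (z * y * z) = z * y * z * (z * x * z)"
    let ?z = "op_of z"
    have zM: "?z \<in> M" and zz: "z * z = z" and sz: "selfadj z"
      using z by (auto simp: projection_def)
    have proj: "is_projection ?z"
      unfolding is_projection_def
      using zz is_adjoint_selfadj[OF _ sz] zM clin by (metis subsetD times_endo.rep_eq)
    have "?z o\<^sub>L T = T o\<^sub>L ?z" if "T \<in> M" for T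
      using arg_cong[OF zc[of "endo_of T"], of op_of] that by (simp add: op_of_simps endo_of_inverse)
    then have "?z \<in> center M" using zM by (simp add: center_def)
    moreover have "abelian_projection M ?z"
      unfolding abelian_projection_def
    proof (intro conjI ballI zM proj)
      fix S T assume "S \<in> M" "T \<in> M"
      then show "(?z o\<^sub>L S o\<^sub>L ?z) o\<^sub>L (?z o\<^sub>L T o\<^sub>L ?z) = (?z o\<^sub>L T o\<^sub>L ?z) o\<^sub>L (?z o\<^sub>L S o\<^sub>L ?z)"
        using arg_cong[OF ab[of "endo_of S" "endo_of T"], of op_of]
        by (simp add: op_of_simps endo_of_inverse)
    qed
    ultimately have "?z = 0"
      using I1 proj unfolding no_central_summand_type_I1_def by blast
    then show "z = 0" by (simp add: zero_endo.rep_eq flip: op_of_inject)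
  qed
qed

section \<open>Iterated Jordan products with unit entries\<close>

lemma jordan_prod_linear:
  "jordan_prod (r *\<^sub>R s) t = r *\<^sub>R jordan_prod s t"
  "jordan_prod s (r *\<^sub>R t) = r *\<^sub>R jordan_prod s t"
  "jordan_prod s id_blinfun = 2 *\<^sub>R s"
  unfolding jordan_prod_def
  by (rule blinfun_eqI, simp add: blinfun.bilinear_simps scaleR_add_right scaleR_2)+

lemma foldl_jordan_prod_id:
  "foldl jordan_prod z (replicate k id_blinfun) = 2 ^ k *\<^sub>R z"
  by (induction k arbitrary: z) (simp_all add: jordan_prod_linear mult.commute)

text \<open>Each unit entry contributes a factor \<open>2\<close>, and the entry \<open>d\<close> a Jordan product instead.\<close>
lemma foldl_jordan_prod_id_update:
  assumes "i < k"
  shows "foldl jordan_prod z ((replicate k id_blinfun)[i := d]) = (2 ^ k / 2) *\<^sub>R jordan_prod z d"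
proof -
  have "(replicate k id_blinfun)[i := d]
      = replicate i id_blinfun @ d # replicate (k - Suc i) (id_blinfun :: 'a \<Rightarrow>\<^sub>L 'a)"
    using assms by (simp add: upd_conv_take_nth_drop)
  moreover have "2 ^ k = 2 * (2 ^ i * 2 ^ (k - Suc i) :: real)"
  proof -
    have "k = Suc (i + (k - Suc i))" using assms by simp
    then show ?thesis by (metis power_Suc power_add)
  qed
  ultimately show ?thesis
    by (simp add: foldl_jordan_prod_id jordan_prod_linear mult.commute)
qed

lemma op_of_jp: "op_of (jp a b) = (1/2) *\<^sub>R jordan_prod (op_of a) (op_of b)"
  by (simp add: jp_def jordan_prod_def op_of_simps)

lemma jordan_q_pair:
  "jordan_q (op_of x # op_of y # replicate k id_blinfun) = op_of (2 ^ Suc k *\<^sub>R jp x y)"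
  by (simp add: jordan_q_def foldl_jordan_prod_id op_of_jp op_of_simps)

text \<open>The entries with index at least \<open>2\<close> all contribute the same term, in which \<open>f 1\<close> replaces a unit.\<close>
lemma jordan_q_pair_tail:
  fixes f :: "('h :: chilbert_space \<Rightarrow>\<^sub>L 'h) \<Rightarrow> ('h \<Rightarrow>\<^sub>L 'h)" and k :: nat
  defines "g \<equiv> \<lambda>x. endo_of (f (op_of x))"
  defines "ts \<equiv> \<lambda>x y. op_of x # op_of y # replicate k id_blinfun"
  shows "(\<Sum>i = 1..<k+2. jordan_q ((ts x y)[i := f (ts x y ! i)]))
    = op_of (2 ^ Suc k *\<^sub>R (jp x (g y) + real k *\<^sub>R jp (jp x y) (g 1)))"
proof -
  have g: "op_of (g x) = f (op_of x)" for x by (simp add: g_def endo_of_inverse)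
  have "(\<Sum>i = 1..<k+2. jordan_q ((ts x y)[i := f (ts x y ! i)]))
      = (\<Sum>i<Suc k. jordan_q ((ts x y)[Suc i := f (ts x y ! Suc i)]))"
    unfolding sum.lessThan_Suc_shift[symmetric] lessThan_atLeast0
    using sum.shift_bounds_Suc_ivl[of "\<lambda>i. jordan_q ((ts x y)[i := f (ts x y ! i)])" 0 "Suc k"]
    by simp
  also have "\<dots> = jordan_q (op_of x # op_of (g y) # replicate k id_blinfun)
      + (\<Sum>i<k. (2 ^ k / 2) *\<^sub>R jordan_prod (jordan_prod (op_of x) (op_of y)) (f id_blinfun))"
    unfolding sum.lessThan_Suc_shift
    by (intro arg_cong2[of _ _ _ _ "(+)"] sum.cong)
      (simp_all add: ts_def g jordan_q_def foldl_jordan_prod_id_update)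
  also have "(\<Sum>i<k. (2 ^ k / 2) *\<^sub>R jordan_prod (jordan_prod (op_of x) (op_of y)) (f id_blinfun))
      = op_of (2 ^ Suc k *\<^sub>R (real k *\<^sub>R jp (jp x y) (g 1)))"
    by (simp add: op_of_simps op_of_jp jordan_prod_linear g sum_constant_scaleR)
  finally show ?thesis
    unfolding jordan_q_pair by (simp add: op_of_simps scaleR_add_right)
qed

section \<open>Generalized Jordan derivations of von Neumann algebras\<close>

theorem corollary4p8:
  fixes n :: nat
    and M :: "('h :: chilbert_space \<Rightarrow>\<^sub>L 'h) set"
    and \<Delta> :: "('h \<Rightarrow>\<^sub>L 'h) \<Rightarrow> ('h \<Rightarrow>\<^sub>L 'h)"
  assumes "n \<ge> 2"
    and "von_neumann_algebra M"
    and "no_central_summand_type_I1 M"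
    and "mult_gen_jordan_derivation n M \<Delta>"
  shows "\<exists>\<mu> \<delta>. \<mu> \<in> center M \<and> derivation_on M \<delta> \<and>
    (\<forall>t\<in>M. \<Delta> t = (\<mu> o\<^sub>L t) + \<delta> t)"
proof -
  interpret no_abelian_summand "endos M"
    using assms(2,3) by (rule von_neumann_no_abelian_summand)
  interpret semiprime_with_idempotents "endos M"
    by (rule semiprime_with_idempotents)
  obtain k where n: "n = k + 2" using assms(1) by (metis add.commute le_Suc_ex)
  obtain \<delta> where \<Delta>M: "\<Delta> \<in> M \<rightarrow> M" and \<delta>M: "\<delta> \<in> M \<rightarrow> M"
    and \<delta>: "\<And>ts. length ts = n \<Longrightarrow> set ts \<subseteq> M \<Longrightarrow>
      \<delta> (jordan_q ts) = (\<Sum>i = 0..<n. jordan_q (ts[i := \<delta> (ts ! i)]))"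
    and \<Delta>: "\<And>ts. length ts = n \<Longrightarrow> set ts \<subseteq> M \<Longrightarrow>
      \<Delta> (jordan_q ts) = jordan_q (ts[0 := \<Delta> (ts ! 0)]) + (\<Sum>i = 1..<n. jordan_q (ts[i := \<delta> (ts ! i)]))"
    using assms(4) unfolding mult_gen_jordan_derivation_def mult_jordan_derivation_def by blast
  define d where "d x = endo_of (\<delta> (op_of x))" for x
  define D where "D x = endo_of (\<Delta> (op_of x))" for x
  have op_d: "op_of (d x) = \<delta> (op_of x)" and op_D: "op_of (D x) = \<Delta> (op_of x)" for x
    by (simp_all add: d_def D_def endo_of_inverse)
  have dA: "d x \<in> endos M" and DA: "D x \<in> endos M" if "x \<in> endos M" for x
    using that \<delta>M \<Delta>M by (auto simp: op_d op_D)
  let ?c = "2 ^ Suc k :: real"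
  have D_rule: "D (?c *\<^sub>R jp x y) = ?c *\<^sub>R (jp (D x) y + (jp x (d y) + real k *\<^sub>R jp (jp x y) (d 1)))"
    and d_rule: "d (?c *\<^sub>R jp x y) = ?c *\<^sub>R (jp (d x) y + (jp x (d y) + real k *\<^sub>R jp (jp x y) (d 1)))"
    if "x \<in> endos M" "y \<in> endos M" for x y
  proof -
    let ?ts = "op_of x # op_of y # replicate k id_blinfun"
    have len: "length ?ts = n" by (simp add: n)
    have "id_blinfun \<in> M" using one_mem by (simp add: one_endo.rep_eq)
    then have set: "set ?ts \<subseteq> M" using that by auto
    have "\<Delta> (jordan_q ?ts) = jordan_q (op_of (D x) # op_of y # replicate k id_blinfun)
        + (\<Sum>i = 1..<k + 2. jordan_q (?ts[i := \<delta> (?ts ! i)]))"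
      using \<Delta>[OF len set] by (simp add: op_D n)
    then show "D (?c *\<^sub>R jp x y) = ?c *\<^sub>R (jp (D x) y + (jp x (d y) + real k *\<^sub>R jp (jp x y) (d 1)))"
      unfolding jordan_q_pair_tail jordan_q_pair d_def[symmetric] op_D[symmetric]
      by (simp add: scaleR_add_right op_of_inverse flip: op_of_inject plus_endo.rep_eq)
    have "\<delta> (jordan_q ?ts) = jordan_q (op_of (d x) # op_of y # replicate k id_blinfun)
        + (\<Sum>i = 1..<k + 2. jordan_q (?ts[i := \<delta> (?ts ! i)]))"
      using \<delta>[OF len set] sum.atLeast_Suc_lessThan[of 0 n "\<lambda>i. jordan_q (?ts[i := \<delta> (?ts ! i)])"]
      by (simp add: op_d n)
    then show "d (?c *\<^sub>R jp x y) = ?c *\<^sub>R (jp (d x) y + (jp x (d y) + real k *\<^sub>R jp (jp x y) (d 1)))"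
      unfolding jordan_q_pair_tail jordan_q_pair d_def[symmetric] op_d[symmetric]
      by (simp add: scaleR_add_right op_of_inverse flip: op_of_inject plus_endo.rep_eq)
  qed
  \<comment> \<open>The pairs \<open>(x, y)\<close> and \<open>(jp x y, 1)\<close> have the same product.\<close>
  have d_twisted: "d (jp x y) = jp (d x) y + jp x (d y) - jp (jp x y) (d 1)"
    if "x \<in> endos M" "y \<in> endos M" for x y
  proof -
    have "?c *\<^sub>R (jp (d x) y + (jp x (d y) + real k *\<^sub>R jp (jp x y) (d 1)))
        = ?c *\<^sub>R (d (jp x y) + (jp (jp x y) (d 1) + real k *\<^sub>R jp (jp x y) (d 1)))"
      using d_rule[OF that] d_rule[OF jp_mem[OF that] one_mem] by simp
    then show ?thesis by simp
  qed
  define \<phi> where "\<phi> x = D x - d x" for x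
  have \<phi>_rule: "\<phi> (jp x y) = jp (\<phi> x) y" if "x \<in> endos M" "y \<in> endos M" for x y
  proof -
    have "?c *\<^sub>R \<phi> (jp x y) = \<phi> (?c *\<^sub>R jp x y)"
      using D_rule[OF jp_mem[OF that] one_mem] d_rule[OF jp_mem[OF that] one_mem]
      by (simp add: \<phi>_def scaleR_add_right scaleR_diff_right)
    also have "\<dots> = ?c *\<^sub>R jp (\<phi> x) y"
      using D_rule[OF that] d_rule[OF that]
      by (simp add: \<phi>_def jp_diff_left scaleR_add_right scaleR_diff_right)
    finally show ?thesis by simp
  qed
  have \<phi>A: "\<phi> x \<in> endos M" if "x \<in> endos M" for x
    unfolding \<phi>_def using that by (intro diff_mem dA DA)
  have \<phi>_central: "\<phi> 1 * x = x * \<phi> 1" if "x \<in> endos M" for x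
    using that by (intro jordan_multiplier(1)[of \<phi>] \<phi>A \<phi>_rule)
  have \<phi>_eq: "\<phi> x = \<phi> 1 * x" if "x \<in> endos M" for x
    using that by (intro jordan_multiplier(2)[of \<phi>] \<phi>A \<phi>_rule)
  have d_central: "d 1 * x = x * d 1" if "x \<in> endos M" for x
    using that by (intro twisted_jordan_derivation(1)[of d] dA d_twisted)
  interpret jordan_multiplicative "endos M" "\<lambda>x. d x - d 1 * x"
    by (intro twisted_jordan_derivation(2)[of d] dA d_twisted)
  define \<mu> where "\<mu> = \<phi> 1 + d 1"
  let ?\<delta>' = "\<lambda>t. op_of (d (endo_of t) - d 1 * endo_of t)"
  have E: "endo_of t \<in> endos M" if "t \<in> M" for t using that by (simp add: endo_of_inverse)
  show ?thesis
  proof (intro exI conjI ballI)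
    have "\<mu> \<in> endos M" unfolding \<mu>_def by (intro add_mem \<phi>A dA one_mem)
    moreover have "\<mu> * x = x * \<mu>" if "x \<in> endos M" for x
      using \<phi>_central[OF that] d_central[OF that] by (simp add: \<mu>_def distrib_left distrib_right)
    then have "op_of \<mu> o\<^sub>L T = T o\<^sub>L op_of \<mu>" if "T \<in> M" for T
      using E[OF that] by (metis UNIV_I endo_of_inverse times_endo.rep_eq)
    ultimately show "op_of \<mu> \<in> center M" by (simp add: center_def)
    have add: "endo_of (s + t) = endo_of s + endo_of t" and mult: "endo_of (s o\<^sub>L t) = endo_of s * endo_of t"
      for s t :: "'h \<Rightarrow>\<^sub>L 'h"
      by (simp_all add: op_of_simps endo_of_inverse flip: op_of_inject)
    show "derivation_on M ?\<delta>'"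
      unfolding derivation_on_def
    proof (intro conjI ballI)
      show "?\<delta>' \<in> M \<rightarrow> M" using maps E by simp
      fix s t assume st: "s \<in> M" "t \<in> M"
      show "?\<delta>' (s + t) = ?\<delta>' s + ?\<delta>' t"
        using delta_additive[OF E E, OF st] unfolding add by (simp only: plus_endo.rep_eq)
      show "?\<delta>' (s o\<^sub>L t) = (?\<delta>' s o\<^sub>L t) + (s o\<^sub>L ?\<delta>' t)"
        using delta_derivation[OF E E, OF st] unfolding mult
        by (simp only: plus_endo.rep_eq times_endo.rep_eq endo_of_inverse UNIV_I)
    qed
    fix t assume t: "t \<in> M"
    have "D (endo_of t) = \<mu> * endo_of t + (d (endo_of t) - d 1 * endo_of t)"
      using \<phi>_eq[OF E[OF t]] by (simp add: \<phi>_def \<mu>_def distrib_right algebra_simps)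
    from arg_cong[OF this, of op_of]
    show "\<Delta> t = (op_of \<mu> o\<^sub>L t) + ?\<delta>' t"
      by (simp only: op_D plus_endo.rep_eq times_endo.rep_eq endo_of_inverse UNIV_I)
  qed
qed

end
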